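(* Let $X_1$, $X_2$ be finite simplicial complexes, $f_1:X_1\to X_1$, $f_2:X_2\to X_2$ continuous maps and $A_1\subset X_1$, $A_2\subset X_2$ subspaces such that $f_1$ has no fixed points in $\overline{A_1}\setminus\mathring{A_1}$ and $f_2$ has no fixed points in $\overline{A_2}\setminus\mathring{A_2}$. Then $$i_c(X_1\times X_2,f_1\times f_2,A_1\times A_2)=i_c(X_1,f_1,A_1)\cdot i_c(X_2,f_2,A_2).$$
   Context: Simplicial complexes are finite and identified with their geometric realizations (so $X_1\times X_2$ is a compact polyhedron). $\overline{A}$ and $\mathring{A}$ denote closure and interior in the ambient complex. Fixed point index: for a compact polyhedron $X$, a continuous map $f:X\to X$ and an open set $U\subset X$ such that $f$ has no fixed points in $\overline{U}\setminus U$, $i(X,f,U)\in\mathbb{Z}$ is the classical fixed point index. Concretely: embed $X$ in some $\mathbb{R}^n$, choose a retraction $r:W\to X$ of an open neighbourhood $W$ of $X$; then $i(X,f,U)$ is the local degree over $0$ of $x\mapsto x-f(r(x))$ on the open set $r^{-1}(U)\subset\mathbb{R}^n$; it does not depend on the choices. Combinatorial fixed point index: for $f:X\to X$ continuous and any subspace $A\subset X$ such that $f$ has no fixed points in $\overline{A}\setminus\mathring{A}$, $i_c(X,f,A):=i(X,f,\mathring{A})$. *)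

theory Defs
  imports "HOL-Analysis.Analysis"
begin

section \<open>Local degree over 0\<close>

text \<open>
  The Leibniz formula with respect to the basis \<^term>\<open>Basis\<close>, the analogue of \<^const>\<open>det\<close>
  for endomorphisms of an arbitrary Euclidean space. Being the determinant of an endomorphism,
  it does not depend on an ordering of the basis.
\<close>

definition endo_det :: "('a::euclidean_space \<Rightarrow> 'a) \<Rightarrow> real" where
  "endo_det L = (\<Sum>p | p permutes Basis. of_int (sign p) * (\<Prod>b\<in>Basis. L b \<bullet> p b))"

definition jacobian :: "('a::euclidean_space \<Rightarrow> 'a) \<Rightarrow> 'a \<Rightarrow> real" where
  "jacobian h x = endo_det (frechet_derivative h (at x))"

definition C1_on :: "'a::euclidean_space set \<Rightarrow> ('a \<Rightarrow> 'a) \<Rightarrow> bool" where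
  "C1_on S h \<longleftrightarrow>
     (\<exists>D. (\<forall>x\<in>S. (h has_derivative blinfun_apply (D x)) (at x)) \<and> continuous_on S D)"

definition regular_value_zero :: "'a::euclidean_space set \<Rightarrow> ('a \<Rightarrow> 'a) \<Rightarrow> bool" where
  "regular_value_zero S h \<longleftrightarrow> (\<forall>x\<in>S. h x = 0 \<longrightarrow> jacobian h x \<noteq> 0)"

definition signed_zero_count :: "'a::euclidean_space set \<Rightarrow> ('a \<Rightarrow> 'a) \<Rightarrow> real" where
  "signed_zero_count S h = (\<Sum>x\<in>{x\<in>S. h x = 0}. sgn (jacobian h x))"

text \<open>
  Let \<open>g\<close> be continuous on the open set \<open>V\<close>, with compact zero set. Choose a bounded open
  \<open>S\<close> containing the zeros of \<open>g\<close>, with closure inside \<open>V\<close>, and a \<open>C\<^sup>1\<close> approximation \<open>h\<close>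
  of \<open>g\<close> that has 0 as a regular value and whose distance to \<open>g\<close> on the closure of \<open>S\<close> is less
  than the minimum of \<open>norm (g y)\<close> over the frontier of \<open>S\<close>. Such choices exist, the set of
  zeros of \<open>h\<close> in \<open>S\<close> is then finite, and the degree is the number of these zeros counted with
  the signs of their Jacobian determinants, which is the same for all choices.
\<close>

definition degree_approximation ::
  "('a::euclidean_space \<Rightarrow> 'a) \<Rightarrow> 'a set \<Rightarrow> 'a set \<Rightarrow> ('a \<Rightarrow> 'a) \<Rightarrow> bool" where
  "degree_approximation g V S h \<longleftrightarrow>
     open S \<and> bounded S \<and> {x\<in>V. g x = 0} \<subseteq> S \<and> closure S \<subseteq> V \<and>
     continuous_on (closure S) h \<and> C1_on S h \<and> regular_value_zero S h \<and>
     (\<forall>x\<in>closure S. \<forall>y\<in>frontier S. norm (h x - g x) < norm (g y))"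

definition local_degree :: "('a::euclidean_space \<Rightarrow> 'a) \<Rightarrow> 'a set \<Rightarrow> int" where
  "local_degree g V =
     (THE d. \<forall>S h. degree_approximation g V S h \<longrightarrow> signed_zero_count S h = of_int d)"


section \<open>Fixed point indices\<close>

text \<open>
  The compact polyhedron \<open>X\<close> is given as a subset of a Euclidean space, and this inclusion
  serves as the embedding; the index is the common value for all neighbourhood retractions.
\<close>

definition fixed_point_index :: "'a::euclidean_space set \<Rightarrow> ('a \<Rightarrow> 'a) \<Rightarrow> 'a set \<Rightarrow> int" where
  "fixed_point_index X f U =
     (THE d. \<forall>W r. open W \<and> retraction W X r \<longrightarrow>
                   local_degree (\<lambda>x. x - f (r x)) {x\<in>W. r x \<in> U} = d)"

definition combinatorial_index :: "'a::euclidean_space set \<Rightarrow> ('a \<Rightarrow> 'a) \<Rightarrow> 'a set \<Rightarrow> int" where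
  "combinatorial_index X f A = fixed_point_index X f (top_of_set X interior_of A)"

end

theory Submission
  imports Defs
begin

text \<open>
  The degree is well defined because the signed zero count is an integral. If \<open>U\<close> is \<open>C\<^sup>1\<close> with
  compact support, then \<open>x \<mapsto> x + t U(x)\<close> permutes a large ball for small \<open>t\<close>, so the
  integral of \<open>det (I + t DU)\<close> over the ball is its volume; this is a polynomial in \<open>t\<close>, hence its
  leading coefficient, the integral of \<open>det DU\<close>, vanishes. Consequently the integral of \<open>det Du\<close>
  does not change when \<open>u\<close> is modified on a compact set. Apply this to \<open>u = \<Phi> \<circ> h\<close>, where \<open>\<Phi>\<close> maps a
  small cube around 0 bijectively to the unit cube and collapses its complement: \<open>det Du\<close> lives near
  the zeros of \<open>h\<close>, and by change of variables each of them contributes its sign times the volume of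
  the unit cube. This yields invariance under linear homotopies, from which uniqueness and homotopy
  invariance of the degree follow by approximation.

  Two retractions \<open>r\<close>, \<open>r'\<close> onto \<open>X\<close> are joined, near the fixed points, by
  \<open>r ((1 - t) r + t r')\<close>, and all zeros of the resulting homotopy are fixed points of \<open>f\<close>; so
  the index may be computed from any retraction. For the product take the product retraction and a
  product of approximations: zeros form a product set and the Jacobian determinants multiply.
\<close>

section \<open>Continuously differentiable maps\<close>

text \<open>Both indices are definite descriptions, so no equation about them is usable before
  existence and uniqueness are settled; most of the work lies there, and the product formula itself
  is short. Approximations are only C^1. The usual proof that the integral of \<open>det DU\<close>
  vanishes writes the determinant as a divergence and differentiates twice; volumes of perturbed
  balls need one derivative only. The same constraint asks for a collapsing map \<Phi> that is C^1
  across the boundary of the cube, which rules out plain truncation. The passage from modifications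
  on a compact set to linear homotopies is a gluing: with a cutoff \<open>c\<close>, the map
  \<open>h0 + c (h1 - h0)\<close> is \<open>h0\<close> far out and \<open>h1\<close> where it
  matters, and its value at \<open>x\<close> is the stage \<open>c x\<close> of the homotopy. Where
  no stage meets the cube, \<Phi> composed with any stage has zero Jacobian, so the gluing is
  invisible to the integral. The nonlinear homotopies that compare retractions are then cut into
  short time steps.\<close>

definition C1_map :: "'a::euclidean_space set \<Rightarrow> ('a \<Rightarrow> 'b::real_normed_vector) \<Rightarrow> bool" where
  "C1_map S h \<longleftrightarrow>
     (\<exists>D. (\<forall>x\<in>S. (h has_derivative blinfun_apply (D x)) (at x)) \<and> continuous_on S D)"

text \<open>\<open>C1_map\<close> frees the codomain, because cutoffs are real valued; on endomaps
  it is the notion that \<open>degree_approximation\<close> uses.\<close>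

lemma C1_on_eq_C1_map: "C1_on S h \<longleftrightarrow> C1_map S h"
  by (simp add: C1_on_def C1_map_def)

lemma C1_mapE:
  assumes "C1_map S h"
  obtains D where "\<And>x. x \<in> S \<Longrightarrow> (h has_derivative blinfun_apply (D x)) (at x)"
    and "continuous_on S D"
  using assms unfolding C1_map_def by blast

text \<open>In finite dimension, continuity in operator norm follows from continuity of the values
  on a basis, so derivatives can be handled as plain functions.\<close>

lemma C1_mapI:
  assumes D: "\<And>x. x \<in> S \<Longrightarrow> (h has_derivative D x) (at x)"
    and cont: "\<And>v. continuous_on S (\<lambda>x. D x v)"
  shows "C1_map S h"
proof -
  have bl: "blinfun_apply (Blinfun (D x)) = D x" if "x \<in> S" for x
    using D[OF that] by (intro bounded_linear_Blinfun_apply has_derivative_bounded_linear)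
  have "continuous_on S (\<lambda>x. Blinfun (D x))"
  proof (rule continuous_on_blinfun_componentwise)
    fix i :: 'a
    show "continuous_on S (\<lambda>x. blinfun_apply (Blinfun (D x)) i)"
      using cont[of i] by (rule continuous_on_eq) (simp add: bl)
  qed
  then show ?thesis
    unfolding C1_map_def by (intro exI[of _ "\<lambda>x. Blinfun (D x)"]) (simp add: D bl)
qed

lemma C1_map_has_derivative:
  assumes "C1_map S h" "x \<in> S"
  shows "(h has_derivative frechet_derivative h (at x)) (at x)"
  using assms by (metis C1_mapE differentiableI frechet_derivative_works)

lemma C1_map_continuous_derivative:
  assumes "C1_map S h"
  shows "continuous_on S (\<lambda>x. frechet_derivative h (at x) v)"
proof -
  obtain D where D: "\<And>x. x \<in> S \<Longrightarrow> (h has_derivative blinfun_apply (D x)) (at x)"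
    and cont: "continuous_on S D" using C1_mapE[OF assms] by blast
  have "continuous_on S (\<lambda>x. blinfun_apply (D x) v)"
    by (intro continuous_intros cont)
  then show ?thesis
    by (rule continuous_on_eq) (use D frechet_derivative_at in metis)
qed

lemma C1_map_continuous_on: "C1_map S h \<Longrightarrow> continuous_on S h"
  using C1_map_has_derivative has_derivative_continuous
  by (metis continuous_at_imp_continuous_on)

section \<open>Closure properties of C^1 maps\<close>

lemma C1_map_subset: "C1_map S h \<Longrightarrow> T \<subseteq> S \<Longrightarrow> C1_map T h"
  unfolding C1_map_def by (meson continuous_on_subset subsetD)

lemma C1_map_const [simp]: "C1_map S (\<lambda>x. c)"
  by (rule C1_mapI[of _ _ "\<lambda>x v. 0"]) auto

lemma C1_map_bounded_linear:
  assumes "bounded_linear f"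
  shows "C1_map S f"
  by (rule C1_mapI[of _ _ "\<lambda>x. f"]) (auto intro: bounded_linear_imp_has_derivative assms)

lemma C1_map_add:
  assumes "C1_map S f" "C1_map S g"
  shows "C1_map S (\<lambda>x. f x + g x)"
proof (rule C1_mapI)
  show "((\<lambda>x. f x + g x) has_derivative
      (\<lambda>v. frechet_derivative f (at x) v + frechet_derivative g (at x) v)) (at x)"
    if "x \<in> S" for x
    by (rule has_derivative_add C1_map_has_derivative assms that)+
  show "continuous_on S (\<lambda>x. frechet_derivative f (at x) v + frechet_derivative g (at x) v)" for v
    by (intro continuous_intros C1_map_continuous_derivative assms)
qed

lemma C1_map_scaleR:
  assumes "C1_map S f" "C1_map S g"
  shows "C1_map S (\<lambda>x. f x *\<^sub>R g x)"
proof (rule C1_mapI)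
  show "((\<lambda>x. f x *\<^sub>R g x) has_derivative
      (\<lambda>v. f x *\<^sub>R frechet_derivative g (at x) v + frechet_derivative f (at x) v *\<^sub>R g x)) (at x)"
    if "x \<in> S" for x
    by (rule has_derivative_scaleR C1_map_has_derivative assms that)+
  show "continuous_on S
      (\<lambda>x. f x *\<^sub>R frechet_derivative g (at x) v + frechet_derivative f (at x) v *\<^sub>R g x)" for v
    by (intro continuous_intros C1_map_continuous_derivative C1_map_continuous_on assms)
qed

lemma C1_map_compose:
  assumes "C1_map S f" "C1_map T g" "f ` S \<subseteq> T"
  shows "C1_map S (\<lambda>x. g (f x))"
proof -
  obtain F where F: "\<And>x. x \<in> S \<Longrightarrow> (f has_derivative blinfun_apply (F x)) (at x)"
    and cF: "continuous_on S F" using C1_mapE[OF assms(1)] by blast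
  obtain G where G: "\<And>x. x \<in> T \<Longrightarrow> (g has_derivative blinfun_apply (G x)) (at x)"
    and cG: "continuous_on T G" using C1_mapE[OF assms(2)] by blast
  show ?thesis
  proof (rule C1_mapI[of _ _ "\<lambda>x v. G (f x) (F x v)"])
    fix x assume "x \<in> S"
    then have "f x \<in> T" using assms(3) by blast
    show "((\<lambda>x. g (f x)) has_derivative (\<lambda>v. G (f x) (F x v))) (at x)"
      using diff_chain_at[OF F[OF \<open>x \<in> S\<close>] G[OF \<open>f x \<in> T\<close>]] by (simp add: o_def)
  next
    fix v
    have "continuous_on S (\<lambda>x. G (f x))"
      using continuous_on_compose2[OF cG C1_map_continuous_on[OF assms(1)]] assms(3) by blast
    then show "continuous_on S (\<lambda>x. G (f x) (F x v))"
      by (intro continuous_intros cF)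
  qed
qed

lemma C1_map_cong:
  assumes "C1_map S f" "open S" "\<And>x. x \<in> S \<Longrightarrow> g x = f x"
  shows "C1_map S g"
proof (rule C1_mapI)
  show "(g has_derivative frechet_derivative f (at x)) (at x)" if "x \<in> S" for x
    by (rule has_derivative_transform_within_open[OF C1_map_has_derivative[OF assms(1) that] assms(2) that])
       (simp add: assms(3))
  show "\<And>v. continuous_on S (\<lambda>x. frechet_derivative f (at x) v)"
    by (rule C1_map_continuous_derivative[OF assms(1)])
qed

lemma C1_map_Un:
  assumes "C1_map S f" "C1_map T f" "open S" "open T"
  shows "C1_map (S \<union> T) f"
proof (rule C1_mapI)
  show "(f has_derivative frechet_derivative f (at x)) (at x)" if "x \<in> S \<union> T" for x
    using that C1_map_has_derivative assms by blast
  show "continuous_on (S \<union> T) (\<lambda>x. frechet_derivative f (at x) v)" for v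
    by (intro continuous_on_open_Un assms C1_map_continuous_derivative)
qed

lemma C1_map_diff:
  assumes "C1_map S f" "C1_map S g"
  shows "C1_map S (\<lambda>x. f x - g x)"
  using C1_map_add[OF assms(1) C1_map_scaleR[OF C1_map_const[of S "-1::real"] assms(2)]] by simp

lemma C1_map_sum:
  assumes "\<And>i. i \<in> I \<Longrightarrow> C1_map S (f i)"
  shows "C1_map S (\<lambda>x. \<Sum>i\<in>I. f i x)"
  using assms by (induction I rule: infinite_finite_induct) (auto intro: C1_map_add)

lemma C1_map_real_polynomial:
  assumes "real_polynomial_function p"
  shows "C1_map S p"
  using assms
proof (induction p rule: real_polynomial_function.induct)
  case (mult f g)
  then show ?case using C1_map_scaleR[of S f g] by simp
qed (auto intro: C1_map_bounded_linear C1_map_add)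

lemma C1_map_polynomial:
  fixes p :: "'a::euclidean_space \<Rightarrow> 'b::euclidean_space"
  assumes "polynomial_function p"
  shows "C1_map S p"
proof -
  have "C1_map S (\<lambda>x. \<Sum>b\<in>Basis. (p x \<bullet> b) *\<^sub>R b)"
  proof (intro C1_map_sum C1_map_scaleR C1_map_const)
    fix b :: 'b
    have "real_polynomial_function ((\<lambda>y. y \<bullet> b) \<circ> p)"
      using assms bounded_linear_inner_left unfolding polynomial_function_def by blast
    then show "C1_map S (\<lambda>x. p x \<bullet> b)"
      using C1_map_real_polynomial by (simp add: o_def)
  qed
  then show ?thesis by (simp add: euclidean_representation)
qed

abbreviation Jdet :: "(real^'n \<Rightarrow> real^'n) \<Rightarrow> real^'n \<Rightarrow> real" where
  "Jdet h x \<equiv> det (matrix (frechet_derivative h (at x)))"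

lemma continuous_on_Jdet:
  fixes h :: "real^'n \<Rightarrow> real^'n"
  assumes "C1_map S h"
  shows "continuous_on S (Jdet h)"
  unfolding det_def matrix_def
  by (auto intro!: continuous_intros C1_map_continuous_derivative[OF assms])


section \<open>The integral of a Jacobian determinant\<close>

text \<open>The determinant of the matrix with rows in \<open>J\<close> taken from \<open>A\<close>
  and the others from the identity, that is, the principal minor of \<open>A\<close> on
  \<open>J\<close>.\<close>

definition det_mix :: "'n::finite set \<Rightarrow> real^'n^'n \<Rightarrow> real" where
  "det_mix J A = (\<Sum>p | p permutes UNIV.
     of_int (sign p) * ((\<Prod>i\<in>J. A $ i $ p i) * (\<Prod>i\<in>-J. mat 1 $ i $ p i)))"

text \<open>Multilinearity in the rows: \<open>J\<close> is the set of rows at which the summand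
  \<open>t A\<close> is chosen. What matters later is that this is a polynomial in \<open>t\<close>,
  with coefficients depending continuously on \<open>A\<close> and leading one
  \<open>det A\<close>.\<close>

lemma det_one_plus_scaleR:
  fixes A :: "real^'n^'n"
  shows "det (mat 1 + t *\<^sub>R A) = (\<Sum>k\<le>CARD('n). (\<Sum>J | card J = k. det_mix J A) * t ^ k)"
proof -
  have "det (mat 1 + t *\<^sub>R A) =
      (\<Sum>p | p permutes UNIV. of_int (sign p) * (\<Prod>i\<in>UNIV. t * A $ i $ p i + mat 1 $ i $ p i))"
    by (simp add: det_def add.commute)
  also have "\<dots> = (\<Sum>p | p permutes UNIV. \<Sum>J\<in>UNIV.
      of_int (sign p) * ((\<Prod>i\<in>J. A $ i $ p i) * (\<Prod>i\<in>-J. mat 1 $ i $ p i)) * t ^ card J)"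
    by (subst prod_add) (simp_all add: sum_distrib_left prod.distrib Compl_eq_Diff_UNIV mult_ac)
  also have "\<dots> = (\<Sum>J\<in>UNIV. det_mix J A * t ^ card J)"
    by (subst sum.swap) (simp add: det_mix_def sum_distrib_right)
  also have "\<dots> = (\<Sum>k\<le>CARD('n). \<Sum>J | J \<in> UNIV \<and> card J = k. det_mix J A * t ^ card J)"
    by (rule sum.group[symmetric]) (auto intro: card_mono)
  also have "\<dots> = (\<Sum>k\<le>CARD('n). (\<Sum>J | card J = k. det_mix J A) * t ^ k)"
    by (simp add: sum_distrib_right)
  finally show ?thesis .
qed

lemma det_mix_UNIV: "det_mix UNIV A = det A"
  by (simp add: det_mix_def det_def)

text \<open>The closed ball is compact and outside it \<open>U\<close> vanishes on an open set, so
  the derivative is bounded everywhere; the Lipschitz bound is the mean value inequality.\<close>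

lemma C1_map_compact_support_bounded_derivative:
  fixes U :: "'a::euclidean_space \<Rightarrow> 'b::real_normed_vector"
  assumes U: "C1_map UNIV U" and zero: "\<And>x. norm x > R \<Longrightarrow> U x = 0"
  obtains L where "L \<ge> 0" and "\<And>x v. norm (frechet_derivative U (at x) v) \<le> L * norm v"
    and "\<And>x y. norm (U x - U y) \<le> L * norm (x - y)"
proof -
  obtain D where D: "\<And>x. (U has_derivative blinfun_apply (D x)) (at x)"
    and cont: "continuous_on UNIV D" using U by (auto simp: C1_map_def)
  have FD: "frechet_derivative U (at x) = D x" for x
    using D frechet_derivative_at by metis
  have "compact (D ` cball 0 R)"
    by (meson compact_continuous_image cont continuous_on_subset compact_cball subset_UNIV)
  then obtain L where L: "\<And>x. x \<in> cball 0 R \<Longrightarrow> norm (D x) \<le> L" and "L > 0"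
    using compact_imp_bounded bounded_pos by (metis imageI)
  have "norm (D x) \<le> L" for x
  proof (cases "x \<in> cball 0 R")
    case False
    have "(U has_derivative (\<lambda>v. 0)) (at x)"
    proof (rule has_derivative_transform_within_open)
      show "((\<lambda>x. 0) has_derivative (\<lambda>v. 0)) (at x)" by simp
      show "open (- cball (0::'a) R)" by (simp add: open_Compl)
      show "x \<in> - cball 0 R" using False by simp
    qed (auto simp: zero)
    then have "blinfun_apply (D x) = (\<lambda>v. 0)"
      using D has_derivative_unique by blast
    then have "D x = 0" by (metis blinfun_eqI zero_blinfun.rep_eq)
    then show ?thesis using \<open>L > 0\<close> by simp
  qed (use L in auto)
  then have bd: "norm (D x) \<le> L" for x .
  have 1: "norm (frechet_derivative U (at x) v) \<le> L * norm v" for x v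
    using norm_blinfun[of "D x" v] bd[of x]
    by (smt (verit) FD mult_right_mono norm_ge_zero)
  have 2: "norm (U x - U y) \<le> L * norm (x - y)" for x y
    by (rule differentiable_bound[of UNIV U "\<lambda>x. blinfun_apply (D x)"])
      (use D bd norm_blinfun.rep_eq in \<open>auto simp: norm_blinfun.rep_eq[symmetric]\<close>)
  show ?thesis using 1 2 \<open>L > 0\<close> by (intro that[of L]) auto
qed

text \<open>Otherwise the determinant, which is 1 at parameter 0, vanishes at some \<open>s\<close>
  in \<open>[0, t]\<close>; a kernel vector then satisfies \<open>v = - s M v\<close>, impossible
  when \<open>s L < 1\<close>. Positivity removes the absolute value from the change of variables
  formula, and only so does a polynomial in \<open>t\<close> appear.\<close>

lemma det_pos_near_identity:
  fixes M :: "real^'n \<Rightarrow> real^'n"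
  assumes "linear M" and M: "\<And>v. norm (M v) \<le> L * norm v" and "0 \<le> t" "t * L < 1"
  shows "det (mat 1 + t *\<^sub>R matrix M) > 0"
proof (rule ccontr)
  assume neg: "\<not> det (mat 1 + t *\<^sub>R matrix M) > 0"
  let ?d = "\<lambda>s. det (mat 1 + s *\<^sub>R matrix M)"
  have "continuous_on {0..t} ?d"
    unfolding det_one_plus_scaleR by (intro continuous_intros)
  moreover have "?d t \<le> 0" "?d 0 \<ge> 0" using neg by auto
  ultimately obtain s where s: "0 \<le> s" "s \<le> t" "?d s = 0"
    using IVT2'[of ?d t 0 0] \<open>0 \<le> t\<close> by auto
  have mv: "(mat 1 + s *\<^sub>R matrix M) *v v = v + s *\<^sub>R M v" for v
    using matrix_vector_mul(2)[OF \<open>linear M\<close>]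
    by (simp add: matrix_vector_mult_add_rdistrib flip: scaleR_matrix_vector_assoc)
  have "\<not> inj ((*v) (mat 1 + s *\<^sub>R matrix M))"
    using s det_nz_iff_inj[of "(*v) (mat 1 + s *\<^sub>R matrix M)"] by simp
  then obtain v where v: "v \<noteq> 0" "v + s *\<^sub>R M v = 0"
    using linear_injective_0[of "(*v) (mat 1 + s *\<^sub>R matrix M)"] mv by auto
  then have "norm v = s * norm (M v)"
    using s by (metis abs_of_nonneg add_eq_0_iff norm_minus_cancel norm_scaleR)
  also have "\<dots> \<le> s * (L * norm v)" using M s by (simp add: mult_left_mono)
  also have "\<dots> = (s * L) * norm v" by simp
  finally have "1 \<le> s * L" using v by (simp add: mult_le_cancel_right1)
  moreover have "0 \<le> L" using M[of v] v by (metis norm_ge_zero order_trans zero_le_mult_iff zero_less_norm_iff linorder_not_le)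
  then have "s * L \<le> t * L" using s by (simp add: mult_right_mono)
  ultimately show False using \<open>t * L < 1\<close> by simp
qed

text \<open>Since \<open>t U\<close> is a contraction, the map is injective, and \<open>y\<close>
  has a preimage by Banach's theorem applied to \<open>y - t U x\<close>. Points outside the ball
  are fixed, so by injectivity no point of the ball can be sent there.\<close>

lemma bij_betw_perturbed_identity:
  fixes U :: "'a::{real_normed_vector, complete_space} \<Rightarrow> 'a"
  assumes zero: "\<And>x. norm x > R \<Longrightarrow> U x = 0"
    and lip: "\<And>x y. norm (U x - U y) \<le> L * norm (x - y)"
    and t: "0 \<le> t" "0 \<le> L" "t * L < 1"
  shows "bij_betw (\<lambda>x. x + t *\<^sub>R U x) (cball 0 R) (cball 0 R)"
proof -
  let ?f = "\<lambda>x. x + t *\<^sub>R U x"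
  have lip': "norm (t *\<^sub>R U x - t *\<^sub>R U y) \<le> (t * L) * norm (x - y)" for x y
  proof -
    have "norm (t *\<^sub>R U x - t *\<^sub>R U y) = t * norm (U x - U y)"
      using t by (simp flip: scaleR_diff_right)
    then show ?thesis using mult_left_mono[OF lip[of x y] t(1)] by (simp add: mult_ac)
  qed
  have inj: "x = y" if "?f x = ?f y" for x y
  proof (rule ccontr)
    assume "x \<noteq> y"
    have "x - y = t *\<^sub>R U y - t *\<^sub>R U x" using that by (simp add: algebra_simps)
    then have "norm (x - y) \<le> (t * L) * norm (x - y)"
      using lip'[of y x] by (simp add: norm_minus_commute)
    then show False using \<open>x \<noteq> y\<close> t by simp
  qed
  have sub: "?f x \<in> cball 0 R" if "x \<in> cball 0 R" for x
  proof (rule ccontr)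
    assume n: "?f x \<notin> cball 0 R"
    then have "?f (?f x) = ?f x" using zero[of "?f x"] by simp
    then show False using inj that n by metis
  qed
  have surj: "\<exists>x\<in>cball 0 R. y = ?f x" if y: "y \<in> cball 0 R" for y
  proof -
    have "\<exists>!x. y - t *\<^sub>R U x = x"
    proof (rule banach_fix_type)
      show "0 \<le> t * L" "t * L < 1" using t by auto
      show "\<forall>x x'. dist (y - t *\<^sub>R U x) (y - t *\<^sub>R U x') \<le> t * L * dist x x'"
        using lip' by (simp add: dist_norm norm_minus_commute)
    qed
    then obtain x where x: "y = ?f x" by (metis diff_add_cancel)
    show ?thesis
    proof (cases "x \<in> cball 0 R")
      case False
      then have "y = x" using x zero by simp
      then show ?thesis using y False by simp
    qed (use x in auto)
  qed
  show ?thesis unfolding bij_betw_def inj_on_def using inj sub surj by blast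
qed

lemma integrable_on_compact_continuous:
  fixes f :: "'a::euclidean_space \<Rightarrow> 'b::euclidean_space"
  assumes "compact K" "continuous_on K f"
  shows "f integrable_on K"
  using borel_integrable_compact[OF assms]
  by (intro set_borel_integral_eq_integral(1)) (simp add: set_integrable_def)

lemma integral_Jdet_compact_support:
  fixes U :: "real^'n::{finite,wellorder} \<Rightarrow> real^'n::_"
  assumes U: "C1_map UNIV U" and zero: "\<And>x. norm x > R \<Longrightarrow> U x = 0"
  shows "integral (cball 0 R) (Jdet U) = 0"
proof -
  let ?B = "cball (0::(real, 'n) vec) R"
  let ?A = "\<lambda>x. matrix (frechet_derivative U (at x))"
  obtain L where L: "L \<ge> 0" and bd: "\<And>x v. norm (frechet_derivative U (at x) v) \<le> L * norm v"
    and lip: "\<And>x y. norm (U x - U y) \<le> L * norm (x - y)"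
    using C1_map_compact_support_bounded_derivative[OF U zero] by blast
  define M where "M k x = (\<Sum>J | card J = k. det_mix J (?A x))" for k x
  have cM: "continuous_on ?B (M k)" for k
    unfolding M_def det_mix_def matrix_def
    by (auto intro!: continuous_intros continuous_on_subset[OF C1_map_continuous_derivative[OF U]])
  have Mint: "M k integrable_on ?B" for k
    by (intro integrable_on_compact_continuous cM compact_cball)
  have vol: "measure lebesgue ?B = (\<Sum>k\<le>CARD('n). integral ?B (M k) * t ^ k)"
    if t: "0 \<le> t" "t * L < 1" for t
  proof -
    let ?f = "\<lambda>x. x + t *\<^sub>R U x"
    let ?f' = "\<lambda>x v. v + t *\<^sub>R frechet_derivative U (at x) v"
    have der: "(?f has_derivative ?f' x) (at x within ?B)" for x
      by (rule has_derivative_at_withinI)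
        (auto intro!: derivative_eq_intros C1_map_has_derivative[OF U])
    have lin: "linear (frechet_derivative U (at x))" for x
      using C1_map_has_derivative[OF U] has_derivative_linear by blast
    have mat: "matrix (?f' x) = mat 1 + t *\<^sub>R ?A x" for x
      by (simp add: matrix_def vec_eq_iff mat_def axis_def)
    have det: "\<bar>det (matrix (?f' x))\<bar> = (\<Sum>k\<le>CARD('n). M k x * t ^ k)" for x
      using det_pos_near_identity[OF lin bd t] unfolding mat
      by (simp only: M_def det_one_plus_scaleR abs_of_pos)
    have bij: "bij_betw ?f ?B ?B"
      using bij_betw_perturbed_identity[OF zero lip t(1) L t(2)] .
    have int: "(\<lambda>x. \<bar>det (matrix (?f' x))\<bar>) integrable_on ?B"
      unfolding det by (intro integrable_sum integrable_on_mult_left Mint) auto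
    have "measure lebesgue (?f ` ?B) = integral ?B (\<lambda>x. \<bar>det (matrix (?f' x))\<bar>)"
      using bij by (intro measure_differentiable_image_eq der int) (auto simp: bij_betw_def)
    also have "\<dots> = (\<Sum>k\<le>CARD('n). integral ?B (M k) * t ^ k)"
      unfolding det by (subst integral_sum) (auto intro: integrable_on_mult_left Mint)
    finally show ?thesis using bij by (simp add: bij_betw_def)
  qed
  \<comment> \<open>The volume is absorbed into the constant coefficient, so that the volume
    identity says that a polynomial vanishes.\<close>
  define c where "c k = integral ?B (M k) - (if k = 0 then measure lebesgue ?B else 0)" for k
  \<comment> \<open>The summand 1 keeps \<open>t L < 1\<close> and the denominator positive, even
    for \<open>L = 0\<close>.\<close>
  have "{0..1 / (L + 1)} \<subseteq> {t. (\<Sum>k\<le>CARD('n). c k * t ^ k) = 0}"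
  proof
    fix t assume t: "t \<in> {0..1 / (L + 1)}"
    have "t * L < 1"
    proof -
      have "t * L \<le> L / (L + 1)" using t L mult_right_mono[of t "1/(L+1)" L] by auto
      also have "\<dots> < 1" using L by simp
      finally show ?thesis .
    qed
    have "(\<Sum>k\<le>CARD('n). c k * t ^ k) = (\<Sum>k\<le>CARD('n). integral ?B (M k) * t ^ k)
        - (\<Sum>k\<le>CARD('n). (if k = 0 then measure lebesgue ?B else 0) * t ^ k)"
      by (simp add: c_def left_diff_distrib sum_subtractf)
    also have "(\<Sum>k\<le>CARD('n). (if k = 0 then measure lebesgue ?B else 0) * t ^ k) = measure lebesgue ?B"
      by (simp add: if_distrib[of "\<lambda>x. x * _"] sum.delta cong: if_cong)
    finally show "t \<in> {t. (\<Sum>k\<le>CARD('n). c k * t ^ k) = 0}"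
      using vol[of t] t \<open>t * L < 1\<close> by simp
  qed
  moreover have "infinite {0..1 / (L + 1)}" using L by (simp add: infinite_Icc)
  ultimately have "infinite {t. (\<Sum>k\<le>CARD('n). c k * t ^ k) = 0}"
    using finite_subset by blast
  \<comment> \<open>As \<open>CARD('n)\<close> is positive, this coefficient is free of the volume
    correction, and \<open>UNIV\<close> is the only \<open>J\<close> that contributes to it.\<close>
  then have "c CARD('n) = 0" using polyfun_finite_roots[of c "CARD('n)"] by blast
  moreover have "{J :: 'n set. card J = CARD('n)} = {UNIV}"
    using card_subset_eq[of "UNIV :: 'n set"] by auto
  then have "M CARD('n) = Jdet U" by (simp add: fun_eq_iff M_def det_mix_UNIV)
  ultimately show ?thesis by (simp add: c_def)
qed


section \<open>Cutoff functions\<close>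

text \<open>The square of the positive part, a truncated power just smooth enough to be C^1.\<close>

definition pos_square :: "real \<Rightarrow> real" where
  "pos_square x = x * max 0 x"

lemma pos_square_nonneg [simp]: "0 \<le> pos_square x"
  by (simp add: pos_square_def max_def mult_nonneg_nonneg)

lemma DERIV_pos_square: "(pos_square has_real_derivative 2 * max 0 x) (at x)"
proof -
  consider "x > 0" | "x < 0" | "x = 0" by linarith
  then show ?thesis
  proof cases
    case 1
    have "((\<lambda>x. x * x) has_real_derivative 2 * max 0 x) (at x)"
      using 1 by (auto intro!: derivative_eq_intros)
    then show ?thesis
      by (rule has_field_derivative_transform_within_open[of _ _ _ "{0<..}"]) (use 1 in \<open>auto simp: pos_square_def\<close>)
  next
    case 2
    have "((\<lambda>x. 0) has_real_derivative 2 * max 0 x) (at x)"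
      using 2 by (auto intro!: derivative_eq_intros)
    then show ?thesis
      by (rule has_field_derivative_transform_within_open[of _ _ _ "{..<0}"]) (use 2 in \<open>auto simp: pos_square_def\<close>)
  next
    case 3
    have "((\<lambda>h. max 0 h) \<longlongrightarrow> max 0 (0::real)) (at 0)"
      by (intro tendsto_intros)
    moreover have "(pos_square (0 + h) - pos_square 0) / h = max 0 h" if "h \<noteq> 0" for h
      using that by (simp add: pos_square_def)
    ultimately have "((\<lambda>h. (pos_square (0 + h) - pos_square 0) / h) \<longlongrightarrow> 0) (at 0)"
      using LIM_equal[of 0 "\<lambda>h. (pos_square (0 + h) - pos_square 0) / h" "max 0"] by simp
    then show ?thesis using 3 by (simp add: DERIV_def)
  qed
qed

text \<open>
  A \<open>C\<^sup>1\<close> version of clipping to \<open>[-1, 1]\<close>: a second difference of \<open>pos_square\<close>, whose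
  derivative is the tent function \<open>2 max(0, 1 - |s|)\<close>.
\<close>

definition clip :: "real \<Rightarrow> real" where
  "clip s = pos_square (s + 1) - 2 * pos_square s + pos_square (s - 1) - 1"

lemma clip_eq:
  "clip s = (if s \<le> -1 then -1 else if s \<le> 0 then (s + 1)^2 - 1 else if s \<le> 1 then 1 - (1 - s)^2 else 1)"
  by (cases "s = -1") (auto simp: clip_def pos_square_def max_def power2_eq_square algebra_simps)

lemma DERIV_clip: "(clip has_real_derivative 2 * max 0 (1 - \<bar>s\<bar>)) (at s)"
proof -
  have "((\<lambda>s. pos_square (s + 1) - 2 * pos_square s + pos_square (s - 1) - 1) has_real_derivative
      2 * max 0 (s + 1) - 2 * (2 * max 0 s) + 2 * max 0 (s - 1)) (at s)"
    by (auto intro!: derivative_eq_intros DERIV_chain2[OF DERIV_pos_square] DERIV_pos_square)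
  moreover have "2 * max 0 (s + 1) - 2 * (2 * max 0 s) + 2 * max 0 (s - 1) = 2 * max 0 (1 - \<bar>s\<bar>)"
    by (auto simp: max_def)
  ultimately show ?thesis unfolding clip_def by simp
qed

lemma bij_betw_clip: "bij_betw clip {-1<..<1} {-1<..<1}"
proof (rule bij_betwI')
  have less: "clip x < clip y" if x: "x \<in> {-1<..<1}" and y: "y \<in> {-1<..<1}" and xy: "x < y" for x y
  proof (rule DERIV_pos_imp_increasing_open[OF xy])
    fix z assume "x < z" "z < y"
    then have "0 < 2 * max 0 (1 - \<bar>z\<bar>)" using x y by auto
    then show "\<exists>y. DERIV clip z :> y \<and> 0 < y" using DERIV_clip by blast
  next
    show "continuous_on {x..y} clip"
      by (meson DERIV_clip DERIV_isCont continuous_at_imp_continuous_on)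
  qed
  show "(clip x = clip y) = (x = y)" if "x \<in> {-1<..<1}" "y \<in> {-1<..<1}" for x y
    using less[OF that] less[OF that(2,1)] by (cases x y rule: linorder_cases) auto
  have bounds: "-1 < clip x \<and> clip x < 1" if "x \<in> {-1<..<1}" for x
  proof (cases "x \<le> 0")
    case True
    then have "(x + 1)^2 > 0" "(x + 1)^2 \<le> 1" using that by (auto simp: power_le_one)
    then show ?thesis using True that by (simp add: clip_eq)
  next
    case False
    then have "(1 - x)^2 > 0" "(1 - x)^2 \<le> 1" using that by (auto simp: power_le_one)
    then show ?thesis using False that by (simp add: clip_eq)
  qed
  then show "clip x \<in> {-1<..<1}" if "x \<in> {-1<..<1}" for x using that by simp
  show "\<exists>x\<in>{-1<..<1}. y = clip x" if y: "y \<in> {-1<..<1}" for y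
  proof -
    have "continuous_on {-1..1} clip"
      by (meson DERIV_clip DERIV_isCont continuous_at_imp_continuous_on)
    then obtain x where x: "-1 \<le> x" "x \<le> 1" "clip x = y"
      using IVT'[of clip "-1" y 1] y by (auto simp: clip_eq)
    moreover have "x \<noteq> -1" "x \<noteq> 1" using x y by (auto simp: clip_eq)
    ultimately show ?thesis by (intro bexI[of _ x]) auto
  qed
qed

lemma C1_map_DERIV:
  assumes "\<And>s. (f has_real_derivative f' s) (at s)" "continuous_on UNIV f'"
  shows "C1_map UNIV f"
  by (rule C1_mapI[where D = "\<lambda>s v. f' s * v"])
    (use assms in \<open>auto simp: has_field_derivative_def intro!: continuous_intros\<close>)

lemma C1_map_pos_square: "C1_map UNIV pos_square"
  by (rule C1_map_DERIV[OF DERIV_pos_square]) (intro continuous_intros)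

lemma C1_map_clip: "C1_map UNIV clip"
  by (rule C1_map_DERIV[OF DERIV_clip]) (intro continuous_intros)

text \<open>Squared distances build the bumps below because the norm is not differentiable at the
  centre.\<close>

lemma C1_map_dist_square:
  fixes a :: "'a::euclidean_space"
  shows "C1_map S (\<lambda>x. (x - a) \<bullet> (x - a))"
proof (rule C1_mapI)
  fix x :: 'a
  have "((\<lambda>x. x - a) has_derivative (\<lambda>v. v)) (at x)"
    by (auto intro!: derivative_eq_intros)
  from has_derivative_inner[OF this this]
  show "((\<lambda>x. (x - a) \<bullet> (x - a)) has_derivative (\<lambda>v. (x - a) \<bullet> v + v \<bullet> (x - a))) (at x)" .
  show "continuous_on S (\<lambda>x. (x - a) \<bullet> v + v \<bullet> (x - a))" for v
    by (intro continuous_intros)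
qed

text \<open>Finitely many bumps cover \<open>K\<close>, and clipping their sum makes it exactly 1
  near \<open>K\<close>. The sets \<open>N\<close> and \<open>T\<close> are exported because
  derivatives are compared on open sets: where the cutoff is identically 1, and off a compact set
  where it is 0.\<close>

lemma C1_cutoff:
  fixes K S :: "'a::euclidean_space set"
  assumes "compact K" "open S" "K \<subseteq> S"
  obtains c :: "'a \<Rightarrow> real" and N T where
    "C1_map UNIV c" "\<And>x. 0 \<le> c x \<and> c x \<le> 1"
    "open N" "K \<subseteq> N" "N \<subseteq> S" "\<And>x. x \<in> N \<Longrightarrow> c x = 1"
    "compact T" "N \<subseteq> T" "T \<subseteq> S" "\<And>x. x \<notin> T \<Longrightarrow> c x = 0"
proof -
  have "\<forall>x\<in>K. \<exists>r>0. cball x (2 * r) \<subseteq> S"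
  proof
    fix x assume "x \<in> K"
    obtain d where "d > 0" "cball x d \<subseteq> S"
      using assms \<open>x \<in> K\<close> by (meson open_contains_cball subsetD)
    then show "\<exists>r>0. cball x (2 * r) \<subseteq> S" by (intro exI[of _ "d / 2"]) auto
  qed
  then obtain r where r: "\<And>x. x \<in> K \<Longrightarrow> r x > 0 \<and> cball x (2 * r x) \<subseteq> S"
    using bchoice[of K "\<lambda>x r. r > 0 \<and> cball x (2 * r) \<subseteq> S"] by blast
  have cover: "K \<subseteq> (\<Union>x\<in>K. ball x (r x))"
  proof
    fix x assume "x \<in> K"
    moreover from this have "x \<in> ball x (r x)" using r by simp
    ultimately show "x \<in> (\<Union>x\<in>K. ball x (r x))" by blast
  qed
  obtain F where F: "F \<subseteq> K" "finite F" "K \<subseteq> (\<Union>x\<in>F. ball x (r x))"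
    by (rule compactE_image[OF assms(1) open_ball cover])
  define N where "N = (\<Union>x\<in>F. ball x (r x))"
  define T where "T = (\<Union>x\<in>F. cball x (2 * r x))"
  \<comment> \<open>The constant 4 is the square of the radius factor 2: a bump vanishes from
    distance \<open>2 * r a\<close> on, and within \<open>r a\<close> its argument is at least 3, so
    its value is at least 9, well in the range where \<open>clip\<close> is 1.\<close>
  define g where "g x = (\<Sum>a\<in>F. pos_square (4 - (1 / (r a)^2) *\<^sub>R ((x - a) \<bullet> (x - a))))" for x
  have sq: "(x - a) \<bullet> (x - a) = (dist a x)^2" for x a :: 'a
    by (metis dist_commute dist_norm power2_norm_eq_inner)
  have C1g: "C1_map UNIV g"
    unfolding g_def
    by (intro C1_map_sum C1_map_compose[OF _ C1_map_pos_square] C1_map_diff C1_map_scaleR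
        C1_map_const C1_map_dist_square) auto
  have gN: "g x \<ge> 1" if x: "x \<in> N" for x
  proof -
    obtain a where a: "a \<in> F" "dist a x < r a" using x unfolding N_def by auto
    then have "r a > 0" using zero_le_dist[of a x] by linarith
    have "(dist a x)^2 \<le> (r a)^2" using a by (intro power_mono) auto
    then have "(1 / (r a)^2) *\<^sub>R ((x - a) \<bullet> (x - a)) \<le> 1"
      using \<open>r a > 0\<close> by (simp add: sq divide_le_eq)
    then have "3 * 3 \<le> pos_square (4 - (1 / (r a)^2) *\<^sub>R ((x - a) \<bullet> (x - a)))"
      unfolding pos_square_def by (intro mult_mono) auto
    also have "\<dots> \<le> g x" unfolding g_def by (rule member_le_sum) (use a F in auto)
    finally show ?thesis by simp
  qed
  have gT: "g x = 0" if "x \<notin> T" for x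
    unfolding g_def
  proof (rule sum.neutral, rule ballI)
    fix a assume a: "a \<in> F"
    have "x \<notin> cball a (2 * r a)" using that a unfolding T_def by blast
    then have "2 * r a \<le> dist a x" by simp
    moreover have "r a > 0" using r a F(1) by blast
    ultimately have "(2 * r a)^2 \<le> (dist a x)^2" by (intro power_mono) auto
    then have "4 \<le> (1 / (r a)^2) *\<^sub>R ((x - a) \<bullet> (x - a))"
      using \<open>r a > 0\<close> by (simp add: sq le_divide_eq power_mult_distrib)
    then show "pos_square (4 - (1 / (r a)^2) *\<^sub>R ((x - a) \<bullet> (x - a))) = 0"
      by (simp add: pos_square_def)
  qed
  have g0: "g x \<ge> 0" for x unfolding g_def by (intro sum_nonneg) auto
  show ?thesis
  proof (rule that[of "\<lambda>x. clip (g x)" N T])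
    show "C1_map UNIV (\<lambda>x. clip (g x))"
      by (rule C1_map_compose[OF C1g C1_map_clip]) auto
    show "0 \<le> clip (g x) \<and> clip (g x) \<le> 1" for x
      using g0[of x] by (auto simp: clip_eq power_le_one)
    show "clip (g x) = 1" if "x \<in> N" for x
      using gN[OF that] by (simp add: clip_eq)
    show "clip (g x) = 0" if "x \<notin> T" for x
      using gT[OF that] by (simp add: clip_eq)
    show NT: "N \<subseteq> T" unfolding N_def T_def
    proof (rule UN_mono[OF order_refl])
      fix a assume "a \<in> F"
      then have "r a > 0" using r F(1) by blast
      then show "ball a (r a) \<subseteq> cball a (2 * r a)" by auto
    qed
    show TS: "T \<subseteq> S" unfolding T_def using r F(1) by (meson UN_least subsetD)
    show "N \<subseteq> S" using NT TS by (rule subset_trans)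
    show "open N" unfolding N_def by (intro open_UN ballI open_ball)
    show "K \<subseteq> N" unfolding N_def by (rule F(3))
    show "compact T" unfolding T_def by (intro compact_UN F(2) compact_cball)
  qed
qed

section \<open>Changing a map on a compact set\<close>

lemma frechet_derivative_cong_open:
  assumes "open N" "x \<in> N" "\<And>y. y \<in> N \<Longrightarrow> f y = g y"
  shows "frechet_derivative f (at x) = frechet_derivative g (at x)"
proof -
  have "(f has_derivative D) (at x) \<longleftrightarrow> (g has_derivative D) (at x)" for D
    using has_derivative_transform_within_open[OF _ assms(1,2)] assms(3) by metis
  then show ?thesis by (simp add: frechet_derivative_def)
qed

text \<open>Both maps are multiplied by a cutoff that is 1 near \<open>K\<close>. The products have
  compact support, so their determinants integrate to 0 over a large ball; off \<open>K\<close>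
  these determinants agree, hence the parts over \<open>K\<close> agree too. The determinants are
  subtracted, not the maps, as \<open>det\<close> is not linear.\<close>

lemma integral_Jdet_eq_if_eq_outside_compact:
  fixes u v :: "real^'n::{finite,wellorder} \<Rightarrow> real^'n::_"
  assumes S: "open S" and K: "compact K" "K \<subseteq> S"
    and C1: "C1_map S u" "C1_map S v" and eq: "\<And>x. x \<in> S - K \<Longrightarrow> u x = v x"
  shows "integral K (Jdet u) = integral K (Jdet v)"
proof -
  obtain c :: "(real, 'n) vec \<Rightarrow> real" and N T where c: "C1_map UNIV c"
    and N: "open N" "K \<subseteq> N" "N \<subseteq> S" "\<And>x. x \<in> N \<Longrightarrow> c x = 1"
    and T: "compact T" "N \<subseteq> T" "T \<subseteq> S" "\<And>x. x \<notin> T \<Longrightarrow> c x = 0"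
    using C1_cutoff[OF K(1) S K(2)] by metis
  \<comment> \<open>Extension by zero remains C^1 because \<open>S\<close> and the complement of
    \<open>T\<close> are open and cover the space.\<close>
  define E where "E w x = (if x \<in> S then c x *\<^sub>R w x else 0)" for w :: "(real, 'n) vec \<Rightarrow> (real, 'n) vec" and x
  obtain R where "\<forall>x\<in>T. norm x \<le> R"
    using compact_imp_bounded[OF T(1)] unfolding bounded_iff by blast
  then have R: "T \<subseteq> cball 0 R" by auto
  have zero: "E w x = 0" if "norm x > R" for w x
  proof -
    have "x \<notin> T" using that R by auto
    then show ?thesis using T(4) by (simp add: E_def)
  qed
  have C1E: "C1_map UNIV (E w)" if "C1_map S w" for w
  proof -
    have "C1_map S (E w)"
      by (rule C1_map_cong[of _ "\<lambda>x. c x *\<^sub>R w x"])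
        (use that c C1_map_subset in \<open>auto simp: E_def S intro!: C1_map_scaleR\<close>)
    moreover have "C1_map (-T) (E w)"
      by (rule C1_map_cong[of _ "\<lambda>x. 0"])
        (use T open_Compl[OF compact_imp_closed[OF T(1)]] in \<open>auto simp: E_def\<close>)
    moreover have "open (-T)" using open_Compl[OF compact_imp_closed[OF T(1)]] .
    ultimately have "C1_map (S \<union> -T) (E w)" using S C1_map_Un by blast
    moreover have "S \<union> -T = UNIV" using T(3) by blast
    ultimately show ?thesis by simp
  qed
  have K_eq: "Jdet (E w) x = Jdet w x" if "x \<in> K" for w x
  proof -
    have "E w y = w y" if "y \<in> N" for y
      using N(3) N(4)[OF that] that by (auto simp: E_def)
    from frechet_derivative_cong_open[OF N(1) _ this] show ?thesis using N(2) that by auto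
  qed
  have out_eq: "Jdet (E u) x = Jdet (E v) x" if "x \<notin> K" for x
  proof -
    have "E u y = E v y" if "y \<in> -K" for y
      using eq that by (auto simp: E_def)
    from frechet_derivative_cong_open[OF open_Compl[OF compact_imp_closed[OF K(1)]] _ this]
    show ?thesis using that by auto
  qed
  have int: "Jdet (E w) integrable_on C" if "C1_map S w" "compact C" for w C
    using continuous_on_Jdet[OF C1E[OF that(1)]] that(2)
    by (metis integrable_on_compact_continuous continuous_on_subset subset_UNIV)
  have "((\<lambda>x. Jdet (E u) x - Jdet (E v) x) has_integral
      integral K (Jdet (E u)) - integral K (Jdet (E v))) K"
    by (intro has_integral_diff integrable_integral int C1 K)
  then have 1: "((\<lambda>x. Jdet (E u) x - Jdet (E v) x) has_integral
      integral K (Jdet (E u)) - integral K (Jdet (E v))) (cball 0 R)"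
    by (rule has_integral_on_superset) (use out_eq N T R in auto)
  have E0: "(Jdet (E w) has_integral 0) (cball 0 R)" if "C1_map S w" for w
    using integrable_integral[OF int[OF that compact_cball]]
      integral_Jdet_compact_support[OF C1E[OF that] zero] by metis
  have 2: "((\<lambda>x. Jdet (E u) x - Jdet (E v) x) has_integral 0 - 0) (cball 0 R)"
    by (intro has_integral_diff E0 C1)
  have "integral K (Jdet (E u)) = integral K (Jdet (E v))"
    using has_integral_unique[OF 1 2] by simp
  moreover have "integral K (Jdet (E w)) = integral K (Jdet w)" for w
    using K_eq by (intro Henstock_Kurzweil_Integration.integral_cong) auto
  ultimately show ?thesis by simp
qed


section \<open>Counting zeros by integration\<close>

text \<open>The map \<Phi> of the overview: coordinates beyond \<open>e\<close> in absolute value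
  saturate at 1 or -1.\<close>

definition clip_map :: "real \<Rightarrow> real^'n \<Rightarrow> real^'n" where
  "clip_map e y = (\<chi> i. clip (y $ i / e))"

lemma has_derivative_vec_lambda:
  fixes f :: "'a::real_normed_vector \<Rightarrow> 'n::finite \<Rightarrow> real"
  assumes "\<And>i. ((\<lambda>x. f x i) has_derivative (\<lambda>v. f' v i)) (at x)"
  shows "((\<lambda>x. \<chi> i. f x i) has_derivative (\<lambda>v. \<chi> i. f' v i)) (at x)"
proof -
  have "((\<lambda>x. (\<chi> i. f x i) \<bullet> b) has_derivative (\<lambda>v. (\<chi> i. f' v i) \<bullet> b)) (at x)"
    if b: "b \<in> Basis" for b :: "real^'n"
  proof -
    obtain i where "b = axis i 1" using b unfolding Basis_vec_def by auto
    then show ?thesis using assms[of i] by (simp add: inner_axis)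
  qed
  then show ?thesis by (subst has_derivative_componentwise_within) blast
qed

lemma has_derivative_clip_map:
  fixes h :: "'a::real_normed_vector \<Rightarrow> real^'n"
  assumes "(h has_derivative D) (at x)"
  shows "((\<lambda>x. clip_map e (h x)) has_derivative
    (\<lambda>v. \<chi> i. (2 * max 0 (1 - \<bar>h x $ i / e\<bar>) / e) * D v $ i)) (at x)"
  unfolding clip_map_def
proof (rule has_derivative_vec_lambda)
  fix i
  have 1: "((\<lambda>x. h x $ i / e) has_derivative (\<lambda>v. D v $ i / e)) (at x)"
    by (rule bounded_linear.has_derivative[OF bounded_linear_compose[OF bounded_linear_divide bounded_linear_vec_nth] assms])
  show "((\<lambda>x. clip (h x $ i / e)) has_derivative
      (\<lambda>v. (2 * max 0 (1 - \<bar>h x $ i / e\<bar>) / e) * D v $ i)) (at x)"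
    using DERIV_compose_FDERIV[OF DERIV_clip 1] by (simp add: mult_ac)
qed

lemma C1_map_clip_map:
  fixes h :: "'a::euclidean_space \<Rightarrow> real^'n"
  assumes "C1_map S h"
  shows "C1_map S (\<lambda>x. clip_map e (h x))"
proof (rule C1_mapI)
  show "((\<lambda>x. clip_map e (h x)) has_derivative
    (\<lambda>v. \<chi> i. (2 * max 0 (1 - \<bar>h x $ i / e\<bar>) / e) * frechet_derivative h (at x) v $ i)) (at x)"
    if "x \<in> S" for x
    by (rule has_derivative_clip_map[OF C1_map_has_derivative[OF assms that]])
  show "continuous_on S (\<lambda>x. \<chi> i. (2 * max 0 (1 - \<bar>h x $ i / e\<bar>) / e) * frechet_derivative h (at x) v $ i)"
    for v
    by (cases "e = 0") (auto intro!: continuous_intros C1_map_continuous_on[OF assms] C1_map_continuous_derivative[OF assms])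
qed

text \<open>Clipping acts on each coordinate separately, so the chain rule multiplies row
  \<open>i\<close> of the Jacobian matrix by the derivative of \<open>clip\<close> at coordinate
  \<open>i\<close>.\<close>

lemma Jdet_clip_map:
  fixes h :: "real^'n \<Rightarrow> real^'n"
  assumes "(h has_derivative D) (at x)"
  shows "Jdet (\<lambda>x. clip_map e (h x)) x = (\<Prod>i\<in>UNIV. 2 * max 0 (1 - \<bar>h x $ i / e\<bar>) / e) * Jdet h x"
proof -
  have D: "frechet_derivative h (at x) = D" using frechet_derivative_at[OF assms] by simp
  have "matrix (frechet_derivative (\<lambda>x. clip_map e (h x)) (at x)) =
      (\<chi> i. (2 * max 0 (1 - \<bar>h x $ i / e\<bar>) / e) *s (matrix D $ i))"
    unfolding frechet_derivative_at[OF has_derivative_clip_map[OF assms], symmetric]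
    by (simp add: matrix_def vec_eq_iff)
  then show ?thesis
    by (simp only: det_rows_mul vec_lambda_eta D)
qed

text \<open>A single saturated coordinate gives a zero row. The tent function vanishes at its edge
  as well, so faces of the cube are included.\<close>

lemma Jdet_clip_map_eq_0:
  fixes h :: "real^'n \<Rightarrow> real^'n"
  assumes "(h has_derivative D) (at x)" "e > 0" "\<bar>h x $ i\<bar> \<ge> e"
  shows "Jdet (\<lambda>x. clip_map e (h x)) x = 0"
proof -
  have "2 * max 0 (1 - \<bar>h x $ i / e\<bar>) / e = 0" using assms by (simp add: field_simps)
  then have "(\<Prod>i\<in>UNIV. 2 * max 0 (1 - \<bar>h x $ i / e\<bar>) / e) = 0"
    by (intro prod_zero) auto
  then show ?thesis unfolding Jdet_clip_map[OF assms(1)] by simp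
qed

lemma sgn_Jdet_clip_map:
  fixes h :: "real^'n \<Rightarrow> real^'n"
  assumes "(h has_derivative D) (at x)" "e > 0" "\<And>i. \<bar>h x $ i\<bar> < e"
  shows "sgn (Jdet (\<lambda>x. clip_map e (h x)) x) = sgn (Jdet h x)"
proof -
  have "2 * max 0 (1 - \<bar>h x $ i / e\<bar>) / e > 0" for i using assms(2) assms(3)[of i] by (simp add: field_simps)
  then have "(\<Prod>i\<in>UNIV. 2 * max 0 (1 - \<bar>h x $ i / e\<bar>) / e) > 0"
    by (intro prod_pos) auto
  then show ?thesis unfolding Jdet_clip_map[OF assms(1)] by (simp add: sgn_mult)
qed

section \<open>Cubes and regular zeros\<close>

definition cube :: "real \<Rightarrow> (real^'n) set" where
  "cube e = {y. \<forall>i. \<bar>y $ i\<bar> < e}"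

lemma mem_cube [simp]: "y \<in> cube e \<longleftrightarrow> (\<forall>i. \<bar>y $ i\<bar> < e)"
  by (simp add: cube_def)

lemma bij_betw_restrict_preimage:
  assumes "bij_betw f A B" "C \<subseteq> B"
  shows "bij_betw f {x \<in> A. f x \<in> C} C"
proof -
  have "f ` {x \<in> A. f x \<in> C} = C"
    using assms bij_betw_imp_surj_on[OF assms(1)] by blast
  then show ?thesis
    using inj_on_subset[OF bij_betw_imp_inj_on[OF assms(1)], of "{x \<in> A. f x \<in> C}"]
    by (auto simp: bij_betw_def)
qed

lemma bij_betw_clip_map:
  assumes "e > 0"
  shows "bij_betw (clip_map e) (cube e :: (real^'n) set) (cube 1)"
proof (rule bij_betw_byWitness)
  let ?g = "inv_into {-1<..<1} clip"
  let ?h = "\<lambda>y :: real^'n. \<chi> i. e * ?g (y $ i)"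
  have div: "y / e \<in> {-1<..<1}" if "\<bar>y\<bar> < e" for y using that assms by (auto simp: field_simps)
  show "\<forall>y\<in>cube e. ?h (clip_map e y) = y"
    using bij_betw_inv_into_left[OF bij_betw_clip] div assms by (auto simp: clip_map_def vec_eq_iff)
  have g: "\<bar>?g t\<bar> < 1 \<and> clip (?g t) = t" if "\<bar>t\<bar> < 1" for t
  proof -
    have t: "t \<in> {-1<..<1}" using that by auto
    have "?g t \<in> {-1<..<1}" using bij_betw_apply[OF bij_betw_inv_into[OF bij_betw_clip] t] .
    then show ?thesis using bij_betw_inv_into_right[OF bij_betw_clip t] by auto
  qed
  show "\<forall>y\<in>cube 1. clip_map e (?h y) = y"
    using g assms by (auto simp: clip_map_def vec_eq_iff)
  have "\<bar>clip (t / e)\<bar> < 1" if "\<bar>t\<bar> < e" for t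
    using bij_betw_apply[OF bij_betw_clip div[OF that]] by auto
  then show "clip_map e ` cube e \<subseteq> cube 1"
    by (auto simp: clip_map_def)
  show "?h ` cube 1 \<subseteq> cube e"
    using g assms by (auto simp: abs_mult)
qed

text \<open>The inverse function theorem, applied inside the open set where the determinant keeps
  the sign it has at \<open>z\<close>.\<close>

lemma regular_point_local_bijection:
  fixes h :: "real^'n \<Rightarrow> real^'n"
  assumes S: "open S" and h: "C1_map S h" and z: "z \<in> S" "Jdet h z \<noteq> 0"
    and W: "open W" "z \<in> W"
  obtains U V where "open U" "z \<in> U" "U \<subseteq> S \<inter> W" "open V" "h z \<in> V" "bij_betw h U V"
    "\<And>x. x \<in> U \<Longrightarrow> sgn (Jdet h x) = sgn (Jdet h z)"
proof -
  obtain D where D: "\<And>x. x \<in> S \<Longrightarrow> (h has_derivative blinfun_apply (D x)) (at x)"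
    and cD: "continuous_on S D" using h by (auto simp: C1_map_def)
  define G where "G = {x \<in> S. Jdet h x * sgn (Jdet h z) > 0} \<inter> W"
  have "open ({x \<in> S. Jdet h x * sgn (Jdet h z) > 0})"
  proof -
    have "continuous_on S (\<lambda>x. Jdet h x * sgn (Jdet h z))"
      by (intro continuous_intros continuous_on_Jdet h)
    from continuous_open_preimage[OF this S open_greaterThan[of 0]] show ?thesis
      by (simp add: vimage_def Int_def)
  qed
  then have oG: "open G" using W by (auto simp: G_def)
  have zG: "z \<in> G" using z W by (auto simp: G_def sgn_if)
  have GS: "G \<subseteq> S" by (auto simp: G_def)
  have lin: "linear (blinfun_apply (D z))" by (simp add: blinfun.bounded_linear_right bounded_linear.linear)
  have "frechet_derivative h (at z) = blinfun_apply (D z)"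
    using frechet_derivative_at[OF D[OF z(1)]] by simp
  then have "inj (blinfun_apply (D z))"
    using det_nz_iff_inj[OF lin] z(2) by simp
  then obtain g where g: "linear g" "g \<circ> blinfun_apply (D z) = id"
    using linear_injective_left_inverse[OF lin] by blast
  have "blinfun_apply (Blinfun g) = g"
    using g(1) by (simp add: bounded_linear_Blinfun_apply linear_conv_bounded_linear)
  then have "Blinfun g o\<^sub>L D z = id_blinfun"
    using g(2) by (intro blinfun_eqI) (simp add: fun_eq_iff)
  then obtain U V k where U: "open U" "U \<subseteq> G" "z \<in> U" "open V" "h z \<in> V" "homeomorphism U V h k"
    using inverse_function_theorem[of G h D z "Blinfun g"] oG zG GS D cD continuous_on_subset
    by (metis subsetD)
  have bij: "bij_betw h U V"
    using U(6) unfolding homeomorphism_def bij_betw_def inj_on_def by metis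
  have sgn: "sgn (Jdet h x) = sgn (Jdet h z)" if "x \<in> U" for x
  proof -
    have "Jdet h x * sgn (Jdet h z) > 0" using that U by (auto simp: G_def)
    then show ?thesis by (auto simp: sgn_if zero_less_mult_iff split: if_splits)
  qed
  have "U \<subseteq> S \<inter> W" using U(2) by (auto simp: G_def)
  then show ?thesis by (rule that[OF U(1,3) _ U(4,5) bij sgn])
qed

text \<open>Since none lie on the frontier, the zeros in \<open>S\<close> form a compact set;
  infinitely many would accumulate at one of them, against local injectivity there.\<close>

lemma finite_regular_zeros:
  fixes h :: "real^'n \<Rightarrow> real^'n"
  assumes S: "open S" "bounded S" and h: "C1_map S h" "continuous_on (closure S) h"
    and bd: "\<And>x. x \<in> frontier S \<Longrightarrow> h x \<noteq> 0"
    and reg: "\<And>x. x \<in> S \<Longrightarrow> h x = 0 \<Longrightarrow> Jdet h x \<noteq> 0"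
  shows "finite {x\<in>S. h x = 0}"
proof (rule ccontr)
  assume inf: "infinite {x\<in>S. h x = 0}"
  let ?Z = "{x\<in>closure S. h x = 0}"
  have "closed ?Z" using continuous_closed_preimage_constant[OF h(2)] by auto
  moreover have eq: "?Z = {x\<in>S. h x = 0}"
    using bd S(1) closure_subset[of S] by (auto simp: frontier_def interior_open)
  ultimately have "compact {x\<in>S. h x = 0}"
    using S(2) by (metis (no_types, lifting) bounded_subset compact_eq_bounded_closed mem_Collect_eq subsetI)
  then obtain z where z: "z \<in> {x\<in>S. h x = 0}" "z islimpt {x\<in>S. h x = 0}"
    using inf unfolding compact_eq_Bolzano_Weierstrass by blast
  have z': "z \<in> S" "Jdet h z \<noteq> 0" using z(1) reg by auto
  obtain U V where U: "open U" "z \<in> U" "bij_betw h U V"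
    using regular_point_local_bijection[OF S(1) h(1) z' open_UNIV UNIV_I] by metis
  then obtain y where "y \<in> {x\<in>S. h x = 0}" "y \<in> U" "y \<noteq> z"
    using z(2) unfolding islimpt_def by blast
  then show False using U z by (auto simp: bij_betw_def inj_on_def)
qed

lemma cube_subset_ball:
  fixes r :: real
  assumes "r > 0"
  obtains d where "d > 0" "\<And>e. e \<le> d \<Longrightarrow> {y :: real^'n. \<forall>i. \<bar>y $ i\<bar> \<le> e} \<subseteq> ball 0 r"
proof -
  \<comment> \<open>With coordinates bounded by \<open>?d\<close>, the sum of their absolute values
    is at most \<open>r / 2\<close>; the factor 2 makes the final inequality strict.\<close>
  let ?d = "r / (2 * real CARD('n))"
  have "y \<in> ball 0 r" if "e \<le> ?d" "\<forall>i. \<bar>y $ i\<bar> \<le> e" for e and y :: "real^'n"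
  proof -
    have "norm y \<le> (\<Sum>i\<in>UNIV. \<bar>y $ i\<bar>)" by (rule norm_le_l1_cart)
    also have "\<dots> \<le> (\<Sum>i\<in>(UNIV :: 'n set). ?d)" using that by (intro sum_mono) (meson order_trans)
    also have "\<dots> = r / 2" by simp
    also have "\<dots> < r" using assms by simp
    finally show ?thesis by simp
  qed
  then show ?thesis using assms by (intro that[of ?d]) auto
qed

lemma measure_cube_pos: "measure lebesgue (cube 1 :: (real^'n) set) > 0" and
  lmeasurable_cube: "(cube 1 :: (real^'n) set) \<in> lmeasurable"
proof -
  have eq: "(cube 1 :: (real^'n) set) = box (\<chi> i. -1) (\<chi> i. 1)"
    by (auto simp: mem_box_cart abs_less_iff)
  then show lm: "(cube 1 :: (real^'n) set) \<in> lmeasurable" by simp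
  have "(0 :: real^'n) \<in> cube 1" by simp
  then have "\<not> negligible (cube 1 :: (real^'n) set)"
    using open_not_negligible[of "cube 1 :: (real^'n) set"] eq open_box by (metis empty_iff)
  then show "measure lebesgue (cube 1 :: (real^'n) set) > 0"
    using lm by (simp add: negligible_iff_measure zero_less_measure_iff)
qed

lemma pos_lower_bound_on_compact:
  fixes f :: "'a::topological_space \<Rightarrow> 'b::real_normed_vector"
  assumes "compact C" "continuous_on C f" and nz: "\<And>x. x \<in> C \<Longrightarrow> f x \<noteq> 0"
  obtains m where "m > 0" "\<And>x. x \<in> C \<Longrightarrow> m \<le> norm (f x)"
proof (cases "C = {}")
  case False
  have "continuous_on C (\<lambda>x. norm (f x))"
    by (intro continuous_intros assms)
  then obtain y where "y \<in> C" "\<forall>x\<in>C. norm (f y) \<le> norm (f x)"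
    using continuous_attains_inf[OF assms(1) False] by blast
  then show ?thesis using that[of "norm (f y)"] nz by simp
qed (use that[of 1] in simp)

text \<open>For small \<open>e\<close> the preimage of the cube splits into one piece around each
  zero, carried bijectively to the unit cube by \<open>clip_map e\<close> after \<open>h\<close>,
  with constant sign of the determinant. \<open>e\<close> and \<open>K\<close> are left free so that
  two maps can be evaluated with the same cube over the same set.\<close>

lemma signed_zero_count_eq_integral:
  fixes h :: "real^'n::{finite,wellorder} \<Rightarrow> real^'n::_"
  assumes S: "open S" "bounded S" and h: "C1_map S h" "continuous_on (closure S) h"
    and bd: "\<And>x. x \<in> frontier S \<Longrightarrow> h x \<noteq> 0"
    and reg: "\<And>x. x \<in> S \<Longrightarrow> h x = 0 \<Longrightarrow> Jdet h x \<noteq> 0"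
  shows "\<exists>d>0. \<forall>e K. 0 < e \<longrightarrow> e \<le> d \<longrightarrow> {x \<in> S. h x \<in> cube e} \<subseteq> K \<longrightarrow> K \<subseteq> S \<longrightarrow>
      integral K (Jdet (\<lambda>x. clip_map e (h x))) =
      measure lebesgue (cube 1 :: (real, 'n) vec set) * (\<Sum>x\<in>{x\<in>S. h x = 0}. sgn (Jdet h x))"
proof -
  define Z where "Z = {x\<in>S. h x = 0}"
  have finZ: "finite Z" unfolding Z_def by (rule finite_regular_zeros[OF S h bd reg])
  \<comment> \<open>Balls of half the distance to the nearest other zero are disjoint.\<close>
  obtain q where q: "\<And>z. q z > 0" "\<And>z w. w \<in> Z \<Longrightarrow> w \<noteq> z \<Longrightarrow> q z \<le> dist z w"
    using finite_set_avoid[OF finZ] by metis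
  have "\<exists>U V. open U \<and> z \<in> U \<and> U \<subseteq> S \<inter> ball z (q z / 2) \<and> open V \<and> 0 \<in> V \<and> bij_betw h U V \<and>
      (\<forall>x\<in>U. sgn (Jdet h x) = sgn (Jdet h z))" if z: "z \<in> Z" for z
  proof -
    have z': "z \<in> S" "h z = 0" "Jdet h z \<noteq> 0" "z \<in> ball z (q z / 2)"
      using z reg q(1)[of z] by (auto simp: Z_def)
    show ?thesis
      using regular_point_local_bijection[OF S(1) h(1) z'(1,3) open_ball z'(4)] z'(2) by metis
  qed
  then obtain U V where UV: "\<And>z. z \<in> Z \<Longrightarrow> open (U z) \<and> z \<in> U z \<and> U z \<subseteq> S \<inter> ball z (q z / 2) \<and>
      open (V z) \<and> 0 \<in> V z \<and> bij_betw h (U z) (V z) \<and> (\<forall>x\<in>U z. sgn (Jdet h x) = sgn (Jdet h z))"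
    by metis
  have disj: "U z \<inter> U w = {}" if zw: "z \<in> Z" "w \<in> Z" "z \<noteq> w" for z w
  proof (rule ccontr)
    assume "U z \<inter> U w \<noteq> {}"
    then obtain x where "x \<in> ball z (q z / 2)" "x \<in> ball w (q w / 2)" using UV zw(1,2) by blast
    then have "dist z w < q z / 2 + q w / 2"
      using dist_triangle_less_add[of z x "q z / 2" w "q w / 2"] by (simp add: dist_commute)
    moreover have "q z \<le> dist z w" "q w \<le> dist z w" using q(2)[of w z] q(2)[of z w] zw by (auto simp: dist_commute)
    ultimately show False by simp
  qed
  have "open (\<Inter>z\<in>Z. V z)" "0 \<in> (\<Inter>z\<in>Z. V z)" using UV finZ by auto
  then obtain r1 where r1: "r1 > 0" "ball 0 r1 \<subseteq> (\<Inter>z\<in>Z. V z)"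
    using open_contains_ball by blast
  have clS: "closure S \<subseteq> S \<union> frontier S" using S(1) by (auto simp: frontier_def interior_open)
  let ?C = "closure S - (\<Union>z\<in>Z. U z)"
  have compC: "compact ?C" using S(2) UV by (intro compact_diff) auto
  have nz: "h x \<noteq> 0" if "x \<in> ?C" for x
    using that clS bd UV unfolding Z_def by blast
  obtain r2 where r2: "r2 > 0" "\<And>x. x \<in> ?C \<Longrightarrow> r2 \<le> norm (h x)"
    using pos_lower_bound_on_compact[OF compC continuous_on_subset[OF h(2) Diff_subset] nz] by blast
  \<comment> \<open>\<open>r1\<close> puts the cube inside every \<open>V z\<close>, so each piece
    maps onto all of it; \<open>r2\<close> keeps values of \<open>h\<close> away from the cube off
    the neighbourhoods \<open>U z\<close>, so there are no other pieces.\<close>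
  obtain d where d: "d > 0"
    "\<And>e. e \<le> d \<Longrightarrow> {y :: (real, 'n) vec. \<forall>i. \<bar>y $ i\<bar> \<le> e} \<subseteq> ball 0 (min r1 r2)"
    using cube_subset_ball[of "min r1 r2"] r1(1) r2(1) by (metis min_less_iff_conj)
  show ?thesis
  proof (intro exI[of _ d] conjI allI impI)
    show "d > 0" by (rule d(1))
    fix e :: real and K
    assume e: "0 < e" "e \<le> d" and K: "{x \<in> S. h x \<in> cube e} \<subseteq> K" "K \<subseteq> S"
    have small: "norm y < r1 \<and> norm y < r2" if "y \<in> cube e" for y :: "(real, 'n) vec"
      using d(2)[OF e(2)] that by (fastforce dest: less_imp_le)
    let ?u = "\<lambda>x. clip_map e (h x)"
    let ?N = "\<lambda>z. {x \<in> U z. h x \<in> cube e}"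
    let ?c = "measure lebesgue (cube 1 :: (real, 'n) vec set)"
    have cu: "open (cube e :: (real, 'n) vec set)"
    proof -
      have "(cube e :: (real, 'n) vec set) = box (\<chi> i. -e) (\<chi> i. e)"
        by (auto simp: mem_box_cart abs_less_iff minus_less_iff)
      then show ?thesis by (simp only: open_box)
    qed
    have hd: "(h has_derivative frechet_derivative h (at x)) (at x)" if "x \<in> S" for x
      by (rule C1_map_has_derivative[OF h(1) that])
    have ud: "(?u has_derivative frechet_derivative ?u (at x)) (at x)" if "x \<in> S" for x
      by (rule C1_map_has_derivative[OF C1_map_clip_map[OF h(1)] that])
    have local: "(Jdet ?u has_integral sgn (Jdet h z) * ?c) (?N z)" if z: "z \<in> Z" for z
    proof -
      have US: "U z \<subseteq> S" using UV z by blast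
      have "open (U z \<inter> h -` cube e)"
        using continuous_open_preimage[of "U z" h] UV[OF z] cu
          continuous_on_subset[OF C1_map_continuous_on[OF h(1)] US] by blast
      then have oN: "open (?N z)" by (simp add: Int_def)
      have sub: "cube e \<subseteq> V z" using small r1(2) z by fastforce
      have bh: "bij_betw h (U z) (V z)" using UV[OF z] by blast
      have "bij_betw h (?N z) (cube e)"
        by (rule bij_betw_restrict_preimage[OF bh sub])
      from bij_betw_trans[OF this bij_betw_clip_map[OF e(1)]]
      have bij: "bij_betw ?u (?N z) (cube 1)" by (simp add: o_def)
      have der: "(?u has_derivative frechet_derivative ?u (at x)) (at x within ?N z)" if "x \<in> ?N z" for x
        using ud that US by (blast intro: has_derivative_at_withinI)
      have leb: "?N z \<in> sets lebesgue" using oN by simp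
      have im: "?u ` ?N z = cube 1" and inj: "inj_on ?u (?N z)" using bij by (auto simp: bij_betw_def)
      have int: "(\<lambda>x. \<bar>Jdet ?u x\<bar>) integrable_on ?N z"
        using measurable_differentiable_image_eq[OF leb der inj, unfolded im] lmeasurable_cube by blast
      have "?c = integral (?N z) (\<lambda>x. \<bar>Jdet ?u x\<bar>)"
        using measure_differentiable_image_eq[OF leb der inj int] by (simp only: im)
      then have "((\<lambda>x. \<bar>Jdet ?u x\<bar>) has_integral ?c) (?N z)"
        using integrable_integral[OF int] by (simp only:)
      then have "((\<lambda>x. sgn (Jdet h z) * \<bar>Jdet ?u x\<bar>) has_integral sgn (Jdet h z) * ?c) (?N z)"
        by (rule has_integral_mult_right)
      then show ?thesis
      proof (rule has_integral_eq[rotated])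
        fix x assume x: "x \<in> ?N z"
        have xU: "x \<in> U z" and "h x \<in> cube e" using x by blast+
        then have "\<And>i. \<bar>h x $ i\<bar> < e" by simp
        then have "sgn (Jdet ?u x) = sgn (Jdet h x)"
          by (rule sgn_Jdet_clip_map[OF hd[OF subsetD[OF US xU]] e(1)])
        also have "\<dots> = sgn (Jdet h z)" using UV[OF z] xU by blast
        finally show "sgn (Jdet h z) * \<bar>Jdet ?u x\<bar> = Jdet ?u x" by (metis mult_sgn_abs)
      qed
    qed
    have "(Jdet ?u has_integral (\<Sum>z\<in>Z. sgn (Jdet h z) * ?c)) (\<Union>z\<in>Z. ?N z)"
    proof (rule has_integral_UN[OF finZ local])
      show "pairwise (\<lambda>z w. negligible (?N z \<inter> ?N w)) Z"
      proof (rule pairwiseI)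
        fix z w assume "z \<in> Z" "w \<in> Z" "z \<noteq> w"
        then have "?N z \<inter> ?N w = {}" using disj by blast
        then show "negligible (?N z \<inter> ?N w)" by (metis negligible_empty)
      qed
    qed
    moreover have NK: "(\<Union>z\<in>Z. ?N z) \<subseteq> K"
    proof (rule UN_least)
      fix z assume "z \<in> Z"
      then have "U z \<subseteq> S" using UV by blast
      then show "?N z \<subseteq> K" using K(1) by blast
    qed
    ultimately have "((\<lambda>x. if x \<in> (\<Union>z\<in>Z. ?N z) then Jdet ?u x else 0) has_integral
        (\<Sum>z\<in>Z. sgn (Jdet h z) * ?c)) K"
      by (simp only: has_integral_restrict[OF NK])
    \<comment> \<open>Elsewhere in \<open>K\<close> the value of \<open>h\<close> is outside the
      cube, so a coordinate is saturated and the determinant is 0.\<close>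
    then have "(Jdet ?u has_integral (\<Sum>z\<in>Z. sgn (Jdet h z) * ?c)) K"
    proof (rule has_integral_eq[rotated])
      fix x assume x: "x \<in> K"
      show "(if x \<in> (\<Union>z\<in>Z. ?N z) then Jdet ?u x else 0) = Jdet ?u x"
      proof (cases "x \<in> (\<Union>z\<in>Z. ?N z)")
        case False
        have xS: "x \<in> S" using x K by blast
        have "h x \<notin> cube e"
        proof
          assume c: "h x \<in> cube e"
          then have "x \<notin> (\<Union>z\<in>Z. U z)" using False by blast
          then have "r2 \<le> norm (h x)" using r2(2)[of x] xS closure_subset by blast
          then show False using small[OF c] by simp
        qed
        then obtain i where "\<bar>h x $ i\<bar> \<ge> e" by (auto simp: not_less)
        then have "Jdet ?u x = 0" by (rule Jdet_clip_map_eq_0[OF hd[OF xS] e(1)])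
        then show ?thesis by (simp only: if_cancel)
      qed (simp only: if_True)
    qed
    then show "integral K (Jdet ?u) = ?c * (\<Sum>x\<in>{x\<in>S. h x = 0}. sgn (Jdet h x))"
      unfolding Z_def by (simp add: integral_unique sum_distrib_left mult.commute)
  qed
qed

text \<open>A third map \<open>k\<close> agrees with \<open>h0\<close> off a compact set
  \<open>T\<close>, which preserves the integral over \<open>T\<close>. On \<open>T\<close> its
  clipped determinant is that of \<open>h1\<close>: near the points where some stage enters the cube
  the maps coincide, and at all other points both determinants vanish.\<close>

lemma signed_zero_count_homotopy_vec:
  fixes h0 h1 :: "real^'n::{finite,wellorder} \<Rightarrow> real^'n::_"
  assumes S: "open S" "bounded S"
    and C1: "C1_map S h0" "C1_map S h1"
    and cont: "continuous_on (closure S) h0" "continuous_on (closure S) h1"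
    and reg0: "\<And>x. x \<in> S \<Longrightarrow> h0 x = 0 \<Longrightarrow> Jdet h0 x \<noteq> 0"
    and reg1: "\<And>x. x \<in> S \<Longrightarrow> h1 x = 0 \<Longrightarrow> Jdet h1 x \<noteq> 0"
    and nz: "\<And>t x. 0 \<le> t \<Longrightarrow> t \<le> 1 \<Longrightarrow> x \<in> frontier S \<Longrightarrow> (1 - t) *\<^sub>R h0 x + t *\<^sub>R h1 x \<noteq> 0"
  shows "(\<Sum>x\<in>{x\<in>S. h0 x = 0}. sgn (Jdet h0 x)) = (\<Sum>x\<in>{x\<in>S. h1 x = 0}. sgn (Jdet h1 x))"
proof -
  let ?c = "measure lebesgue (cube 1 :: (real, 'n) vec set)"
  have bd: "\<And>x. x \<in> frontier S \<Longrightarrow> h0 x \<noteq> 0" "\<And>x. x \<in> frontier S \<Longrightarrow> h1 x \<noteq> 0"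
    using nz[of 0] nz[of 1] by auto
  obtain d0 where d0: "d0 > 0"
    "\<And>e K. 0 < e \<Longrightarrow> e \<le> d0 \<Longrightarrow> {x \<in> S. h0 x \<in> cube e} \<subseteq> K \<Longrightarrow> K \<subseteq> S \<Longrightarrow>
      integral K (Jdet (\<lambda>x. clip_map e (h0 x))) = ?c * (\<Sum>x\<in>{x\<in>S. h0 x = 0}. sgn (Jdet h0 x))"
    using signed_zero_count_eq_integral[OF S C1(1) cont(1) bd(1) reg0] by blast
  obtain d1 where d1: "d1 > 0"
    "\<And>e K. 0 < e \<Longrightarrow> e \<le> d1 \<Longrightarrow> {x \<in> S. h1 x \<in> cube e} \<subseteq> K \<Longrightarrow> K \<subseteq> S \<Longrightarrow>
      integral K (Jdet (\<lambda>x. clip_map e (h1 x))) = ?c * (\<Sum>x\<in>{x\<in>S. h1 x = 0}. sgn (Jdet h1 x))"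
    using signed_zero_count_eq_integral[OF S C1(2) cont(2) bd(2) reg1] by blast
  define G where "G p = (1 - fst p) *\<^sub>R h0 (snd p) + fst p *\<^sub>R h1 (snd p)" for p
  define P where "P = {0..1::real} \<times> closure S"
  have compP: "compact P"
    unfolding P_def using S(2) by (intro compact_Times) auto
  have contG: "continuous_on P G"
    unfolding G_def P_def
    by (intro continuous_intros continuous_on_compose2[OF cont(1)] continuous_on_compose2[OF cont(2)]) auto
  have Gnz: "G p \<noteq> 0" if "p \<in> {0..1} \<times> frontier S" for p
    using that nz[of "fst p" "snd p"] by (auto simp: G_def)
  have FP: "{0..1} \<times> frontier S \<subseteq> P" by (auto simp: P_def frontier_def)
  obtain m where m: "m > 0" "\<And>p. p \<in> {0..1} \<times> frontier S \<Longrightarrow> m \<le> norm (G p)"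
    using pos_lower_bound_on_compact[OF _ continuous_on_subset[OF contG FP] Gnz] compact_frontier_bounded[OF S(2)]
    by (metis compact_Icc compact_Times)
  obtain d where d: "d > 0"
    "\<And>e. e \<le> d \<Longrightarrow> {y :: (real, 'n) vec. \<forall>i. \<bar>y $ i\<bar> \<le> e} \<subseteq> ball 0 m"
    using cube_subset_ball[OF m(1)] by metis
  \<comment> \<open>\<open>d\<close> keeps the cube within radius \<open>m\<close>, so no stage
    enters it over the frontier; \<open>d0\<close> and \<open>d1\<close> make both integral formulas
    valid for this \<open>e\<close>.\<close>
  define e where "e = min d (min d0 d1)"
  have e: "0 < e" "e \<le> d" "e \<le> d0" "e \<le> d1" using d(1) d0(1) d1(1) by (auto simp: e_def)
  \<comment> \<open>Closed, unlike \<open>cube e\<close>, so that its preimage in the compact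
    \<open>P\<close> is compact.\<close>
  define Q where "Q = {y :: (real, 'n) vec. \<forall>i. \<bar>y $ i\<bar> \<le> e}"
  have closedQ: "closed Q"
  proof -
    have "Q = cbox (\<chi> i. -e) (\<chi> i. e)"
      by (auto simp: Q_def mem_box_cart abs_le_iff minus_le_iff)
    then show ?thesis by (simp only: closed_cbox)
  qed
  have cubeQ: "cube e \<subseteq> Q" by (auto simp: Q_def less_imp_le)
  define K where "K = snd ` (P \<inter> G -` Q)"
  have "closed (P \<inter> G -` Q)"
    using continuous_closed_preimage[OF contG compact_imp_closed[OF compP] closedQ] .
  then have "compact (P \<inter> G -` Q)"
    using compact_Int_closed[OF compP] by (metis inf.left_idem)
  then have compK: "compact K"
    unfolding K_def by (intro compact_continuous_image continuous_intros)
  have KI: "x \<in> K" if "G (t, x) \<in> Q" "0 \<le> t" "t \<le> 1" "x \<in> S" for t x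
    using that closure_subset[of S] by (force simp: K_def P_def)
  have KS: "K \<subseteq> S"
  proof
    fix x assume "x \<in> K"
    then obtain t where t: "t \<in> {0..1}" "x \<in> closure S" "G (t, x) \<in> Q"
      by (auto simp: K_def P_def)
    show "x \<in> S"
    proof (rule ccontr)
      assume "x \<notin> S"
      then have "x \<in> frontier S" using t(2) S(1) by (simp add: frontier_def interior_open)
      then have "m \<le> norm (G (t, x))" using m(2) t(1) by simp
      moreover have "G (t, x) \<in> ball 0 m" using t(3) d(2)[OF e(2)] by (auto simp: Q_def)
      ultimately show False by simp
    qed
  qed
  obtain c :: "(real, 'n) vec \<Rightarrow> real" and N T where c: "C1_map UNIV c" "\<And>x. 0 \<le> c x \<and> c x \<le> 1"
    and N: "open N" "K \<subseteq> N" "N \<subseteq> S" "\<And>x. x \<in> N \<Longrightarrow> c x = 1"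
    and T: "compact T" "N \<subseteq> T" "T \<subseteq> S" "\<And>x. x \<notin> T \<Longrightarrow> c x = 0"
    using C1_cutoff[OF compK S(1) KS] by metis
  define k where "k x = h0 x + c x *\<^sub>R (h1 x - h0 x)" for x
  have C1k: "C1_map S k"
    unfolding k_def
    by (intro C1_map_add C1_map_scaleR C1_map_diff C1 C1_map_subset[OF c(1)] subset_UNIV)
  \<comment> \<open>The value of \<open>k\<close> is itself a stage of the homotopy, hence outside
    \<open>Q\<close> wherever every stage is.\<close>
  have kG: "k x = G (c x, x)" for x by (simp add: k_def G_def algebra_simps)
  have "integral T (Jdet (\<lambda>x. clip_map e (h0 x))) = integral T (Jdet (\<lambda>x. clip_map e (k x)))"
  proof (rule integral_Jdet_eq_if_eq_outside_compact[OF S(1) T(1,3)])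
    show "C1_map S (\<lambda>x. clip_map e (h0 x))" by (rule C1_map_clip_map[OF C1(1)])
    show "C1_map S (\<lambda>x. clip_map e (k x))" by (rule C1_map_clip_map[OF C1k])
    show "clip_map e (h0 x) = clip_map e (k x)" if "x \<in> S - T" for x
      using T(4)[of x] that by (simp add: k_def)
  qed
  also have "\<dots> = integral T (Jdet (\<lambda>x. clip_map e (h1 x)))"
  proof (rule Henstock_Kurzweil_Integration.integral_cong)
    fix x assume "x \<in> T"
    then have xS: "x \<in> S" using T(3) by blast
    show "Jdet (\<lambda>x. clip_map e (k x)) x = Jdet (\<lambda>x. clip_map e (h1 x)) x"
    proof (cases "x \<in> K")
      case True
      have "clip_map e (k y) = clip_map e (h1 y)" if "y \<in> N" for y
        using N(4)[OF that] by (simp add: k_def)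
      from frechet_derivative_cong_open[OF N(1) subsetD[OF N(2) True] this] show ?thesis
        by (simp only:)
    next
      case False
      have zero: "Jdet (\<lambda>x. clip_map e (w x)) x = 0" if w: "C1_map S w" "w x \<notin> Q" for w
      proof -
        obtain i where "\<not> \<bar>w x $ i\<bar> \<le> e" using w(2) by (auto simp: Q_def)
        then have "\<bar>w x $ i\<bar> \<ge> e" by simp
        then show ?thesis
          by (rule Jdet_clip_map_eq_0[OF C1_map_has_derivative[OF w(1) xS] e(1)])
      qed
      have "k x \<notin> Q" using KI[of "c x" x] kG[of x] c(2)[of x] xS False by auto
      moreover have "h1 x \<notin> Q" using KI[of 1 x] xS False by (auto simp: G_def)
      ultimately show ?thesis using zero[OF C1k] zero[OF C1(2)] by simp
    qed
  qed
  finally have int_eq: "integral T (Jdet (\<lambda>x. clip_map e (h0 x))) = integral T (Jdet (\<lambda>x. clip_map e (h1 x)))" .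
  have sub0: "{x \<in> S. h0 x \<in> cube e} \<subseteq> T"
  proof
    fix x assume x: "x \<in> {x \<in> S. h0 x \<in> cube e}"
    then have "G (0, x) \<in> Q" using cubeQ by (auto simp: G_def)
    then show "x \<in> T" using KI[of 0 x] x N(2) T(2) by auto
  qed
  have sub1: "{x \<in> S. h1 x \<in> cube e} \<subseteq> T"
  proof
    fix x assume x: "x \<in> {x \<in> S. h1 x \<in> cube e}"
    then have "G (1, x) \<in> Q" using cubeQ by (auto simp: G_def)
    then show "x \<in> T" using KI[of 1 x] x N(2) T(2) by auto
  qed
  have cne: "?c \<noteq> 0" using measure_cube_pos[where 'n='n] by (metis less_irrefl)
  have ceq: "?c * (\<Sum>x\<in>{x\<in>S. h0 x = 0}. sgn (Jdet h0 x)) = ?c * (\<Sum>x\<in>{x\<in>S. h1 x = 0}. sgn (Jdet h1 x))"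
    using d0(2)[OF e(1,3) sub0 T(3)] d1(2)[OF e(1,4) sub1 T(3)] int_eq by (simp only:)
  show ?thesis by (rule iffD1[OF mult_left_cancel[OF cne] ceq])
qed


section \<open>Transfer to arbitrary Euclidean spaces\<close>

text \<open>
  The change of variables formula and Sard's theorem are available only for vectors indexed by a
  finite well-ordered type, so the basis of a Euclidean space is made into such a type.
\<close>

typedef (overloaded) 'a basis_index = "Basis :: 'a::euclidean_space set"
  using nonempty_Basis by blast

lemma bij_betw_Rep_basis_index: "bij_betw Rep_basis_index UNIV (Basis :: 'a::euclidean_space set)"
  by (metis bij_betw_def Rep_basis_index_inject injI type_definition.Rep_range type_definition_basis_index)

instance basis_index :: (euclidean_space) finite
  by standard (metis bij_betw_finite bij_betw_Rep_basis_index finite_Basis)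

text \<open>Any injection will do: the order only serves to meet a type class, and determinants do
  not depend on it.\<close>

definition basis_number :: "'a::euclidean_space basis_index \<Rightarrow> nat" where
  "basis_number = (SOME f. inj f)"

lemma inj_basis_number: "inj (basis_number :: 'a::euclidean_space basis_index \<Rightarrow> nat)"
proof -
  have "\<exists>f :: 'a basis_index \<Rightarrow> nat. inj f"
    using finite_imp_inj_to_nat_seg[OF finite[of "UNIV :: 'a basis_index set"]] by blast
  then show ?thesis unfolding basis_number_def by (rule someI_ex)
qed

instantiation basis_index :: (euclidean_space) wellorder
begin

definition less_eq_basis_index :: "'a basis_index \<Rightarrow> 'a basis_index \<Rightarrow> bool" where
  "less_eq_basis_index i j \<longleftrightarrow> basis_number i \<le> basis_number j"

definition less_basis_index :: "'a basis_index \<Rightarrow> 'a basis_index \<Rightarrow> bool" where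
  "less_basis_index i j \<longleftrightarrow> basis_number i < basis_number j"

instance
proof
  fix P :: "'a basis_index \<Rightarrow> bool" and i
  assume step: "\<And>i. (\<And>j. j < i \<Longrightarrow> P j) \<Longrightarrow> P i"
  show "P i"
    by (induction i rule: measure_induct_rule[of basis_number])
      (auto intro: step simp: less_basis_index_def)
qed (auto simp: less_eq_basis_index_def less_basis_index_def dest: injD[OF inj_basis_number])

end

section \<open>Coordinates and determinants\<close>

definition to_vec :: "'a::euclidean_space \<Rightarrow> real^'a basis_index" where
  "to_vec x = (\<chi> i. x \<bullet> Rep_basis_index i)"

definition of_vec :: "real^'a basis_index \<Rightarrow> 'a::euclidean_space" where
  "of_vec y = (\<Sum>i\<in>UNIV. y $ i *\<^sub>R Rep_basis_index i)"

lemma sum_basis_index: "(\<Sum>i\<in>UNIV. f (Rep_basis_index i)) = sum f (Basis :: 'a::euclidean_space set)"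
  by (rule sum.reindex_bij_betw[OF bij_betw_Rep_basis_index])

lemma of_vec_to_vec [simp]: "of_vec (to_vec x) = x"
  unfolding of_vec_def to_vec_def vec_lambda_beta
  by (subst sum_basis_index[of "\<lambda>b. (x \<bullet> b) *\<^sub>R b"]) (rule euclidean_representation)

lemma Rep_basis_index_inner:
  "Rep_basis_index i \<bullet> Rep_basis_index j = (if i = j then 1 else 0)"
  by (simp add: inner_Basis Rep_basis_index Rep_basis_index_inject)

lemma to_vec_of_vec [simp]: "to_vec (of_vec y) = y"
  by (simp add: vec_eq_iff of_vec_def to_vec_def inner_sum_left Rep_basis_index_inner if_distrib
      cong: if_cong)

lemma to_vec_image: "to_vec ` A = of_vec -` A"
proof (rule set_eqI)
  show "v \<in> to_vec ` A \<longleftrightarrow> v \<in> of_vec -` A" for v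
    using to_vec_of_vec[of v] of_vec_to_vec by (metis imageE imageI vimageE vimageI)
qed

lemma linear_to_vec: "linear to_vec"
  by (rule linearI) (simp_all add: to_vec_def vec_eq_iff inner_left_distrib)

lemma linear_of_vec: "linear of_vec"
  by (rule linearI) (simp_all add: of_vec_def algebra_simps sum.distrib scaleR_sum_right)

lemma bounded_linear_to_vec: "bounded_linear to_vec"
  using linear_to_vec by (simp add: linear_conv_bounded_linear)

lemma bounded_linear_of_vec: "bounded_linear of_vec"
  using linear_of_vec by (simp add: linear_conv_bounded_linear)

lemma open_to_vec_image: "open A \<Longrightarrow> open (to_vec ` A)"
  unfolding to_vec_image by (rule open_vimage[OF _ linear_continuous_on[OF bounded_linear_of_vec]])

lemma of_vec_axis [simp]: "of_vec (axis i 1) = Rep_basis_index i"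
  by (simp add: of_vec_def axis_def if_distrib[of "\<lambda>c. c *\<^sub>R _"] cong: if_cong)

text \<open>A determinant over an arbitrary index set, the common form of \<open>endo_det\<close>
  and \<open>det\<close>; it can be reindexed, and split along a partition of the indices.\<close>

definition leibniz_sum :: "'a set \<Rightarrow> ('a \<Rightarrow> 'a \<Rightarrow> real) \<Rightarrow> real" where
  "leibniz_sum A M = (\<Sum>p | p permutes A. of_int (sign p) * (\<Prod>a\<in>A. M a (p a)))"

lemma endo_det_eq_leibniz_sum: "endo_det L = leibniz_sum Basis (\<lambda>b c. L b \<bullet> c)"
  by (simp add: endo_det_def leibniz_sum_def)

text \<open>Transporting permutations along \<open>f\<close> is a bijection between the two
  permutation groups that preserves signs.\<close>

lemma leibniz_sum_reindex:
  assumes "finite A" and f: "bij_betw f A B"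
  shows "leibniz_sum B M = leibniz_sum A (\<lambda>a b. M (f a) (f b))"
proof -
  let ?m = "map_permutation A f" and ?k = "map_permutation B (inv_into A f)"
  have bij: "bij_betw ?m {p. p permutes A} {p. p permutes B}"
  proof (rule bij_betw_byWitness[of _ ?k])
    have g: "bij_betw (inv_into A f) B A" by (rule bij_betw_inv_into[OF f])
    show "?m ` {p. p permutes A} \<subseteq> {p. p permutes B}"
      using map_permutation_permutes[OF f] by blast
    show "?k ` {p. p permutes B} \<subseteq> {p. p permutes A}"
      using map_permutation_permutes[OF g] by blast
    show "\<forall>p\<in>{p. p permutes A}. ?k (?m p) = p"
      by (intro ballI map_permutation_compose_inv[OF f])
        (simp_all add: bij_betw_inv_into_left[OF f])
    show "\<forall>p\<in>{p. p permutes B}. ?m (?k p) = p"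
      by (intro ballI map_permutation_compose_inv[OF g])
        (simp_all add: bij_betw_inv_into_right[OF f])
  qed
  have inj: "inj_on f A" using f by (simp add: bij_betw_def)
  have "leibniz_sum B M = (\<Sum>p\<in>{p. p permutes A}. of_int (sign (?m p)) * (\<Prod>b\<in>B. M b (?m p b)))"
    unfolding leibniz_sum_def by (rule sum.reindex_bij_betw[OF bij, symmetric])
  also have "\<dots> = leibniz_sum A (\<lambda>a b. M (f a) (f b))"
    unfolding leibniz_sum_def
  proof (rule sum.cong[OF refl])
    fix p assume "p \<in> {p. p permutes A}"
    then have p: "p permutes A" by simp
    have "sign (?m p) = sign p"
      by (rule sign_map_permutation[OF inj p assms(1)])
    moreover have "(\<Prod>b\<in>B. M b (?m p b)) = (\<Prod>a\<in>A. M (f a) (?m p (f a)))"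
      by (rule prod.reindex_bij_betw[OF f, symmetric])
    moreover have "?m p (f a) = f (p a)" if "a \<in> A" for a
      by (rule map_permutation_apply[OF inj that])
    ultimately show "of_int (sign (?m p)) * (\<Prod>b\<in>B. M b (?m p b)) =
        of_int (sign p) * (\<Prod>a\<in>A. M (f a) (f (p a)))"
      by simp
  qed
  finally show ?thesis .
qed

lemma endo_det_eq_det:
  fixes L :: "'a::euclidean_space \<Rightarrow> 'a"
  shows "endo_det L = det (matrix (\<lambda>v. to_vec (L (of_vec v))))"
proof -
  let ?A = "matrix (\<lambda>v. to_vec (L (of_vec v)))"
  \<comment> \<open>In \<open>endo_det\<close> the rows are the images of basis vectors, which are
    the columns of \<open>matrix\<close>; hence the transpose.\<close>
  have "det ?A = det (transpose ?A)" by simp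
  also have "\<dots> = leibniz_sum UNIV (\<lambda>i j. L (Rep_basis_index i) \<bullet> Rep_basis_index j)"
    by (simp add: leibniz_sum_def det_def transpose_def matrix_def to_vec_def)
  also have "\<dots> = endo_det L"
    unfolding endo_det_eq_leibniz_sum
    by (rule leibniz_sum_reindex[OF finite bij_betw_Rep_basis_index, symmetric])
  finally show ?thesis by simp
qed

text \<open>Conjugation by the linear isomorphism \<open>to_vec\<close> carries zeros to zeros and
  frontier to frontier, and keeps Jacobian determinants.\<close>

lemma signed_zero_count_homotopy:
  fixes h0 h1 :: "'a::euclidean_space \<Rightarrow> 'a"
  assumes S: "open S" "bounded S"
    and C1: "C1_map S h0" "C1_map S h1"
    and cont: "continuous_on (closure S) h0" "continuous_on (closure S) h1"
    and reg: "regular_value_zero S h0" "regular_value_zero S h1"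
    and nz: "\<And>t x. 0 \<le> t \<Longrightarrow> t \<le> 1 \<Longrightarrow> x \<in> frontier S \<Longrightarrow> (1 - t) *\<^sub>R h0 x + t *\<^sub>R h1 x \<noteq> 0"
  shows "signed_zero_count S h0 = signed_zero_count S h1"
proof -
  let ?S = "to_vec ` S"
  define C where "C h v = to_vec (h (of_vec v))" for h :: "'a \<Rightarrow> 'a" and v
  have oS: "open ?S" by (rule open_to_vec_image[OF S(1)])
  have inj: "inj to_vec" by (metis injI of_vec_to_vec)
  have to0: "to_vec x = 0 \<longleftrightarrow> x = 0" for x :: 'a
    using inj linear_0[OF linear_to_vec] by (metis of_vec_to_vec)
  have cl: "closure ?S = to_vec ` closure S"
    by (rule closure_injective_linear_image[OF linear_to_vec inj, symmetric])
  have fr: "of_vec v \<in> frontier S" if "v \<in> frontier ?S" for v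
    using that oS S(1) inj unfolding frontier_def interior_open[OF oS] interior_open[OF S(1)] cl
    by (auto simp: inj_image_mem_iff)
  have der: "(C h has_derivative (\<lambda>v. to_vec (frechet_derivative h (at x) (of_vec v)))) (at (to_vec x))"
    if "C1_map S h" "x \<in> S" for h x
  proof -
    have "(h has_derivative frechet_derivative h (at x)) (at (of_vec (to_vec x)))"
      using C1_map_has_derivative[OF that] by simp
    then have "((\<lambda>v. h (of_vec v)) has_derivative (\<lambda>v. frechet_derivative h (at x) (of_vec v))) (at (to_vec x))"
      by (rule has_derivative_compose[OF bounded_linear_imp_has_derivative[OF bounded_linear_of_vec]])
    from bounded_linear.has_derivative[OF bounded_linear_to_vec this] show ?thesis
      unfolding C_def .
  qed
  have J: "Jdet (C h) (to_vec x) = jacobian h x" if "C1_map S h" "x \<in> S" for h x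
    using frechet_derivative_at[OF der[OF that]] by (simp add: jacobian_def endo_det_eq_det)
  have count: "(\<Sum>v\<in>{v\<in>?S. C h v = 0}. sgn (Jdet (C h) v)) = signed_zero_count S h" if h: "C1_map S h" for h
  proof -
    have "{v\<in>?S. C h v = 0} = to_vec ` {x\<in>S. h x = 0}"
      by (auto simp: C_def to0)
    then have "(\<Sum>v\<in>{v\<in>?S. C h v = 0}. sgn (Jdet (C h) v)) = (\<Sum>x\<in>{x\<in>S. h x = 0}. sgn (Jdet (C h) (to_vec x)))"
      by (simp add: sum.reindex inj_on_subset[OF inj])
    also have "\<dots> = signed_zero_count S h"
      unfolding signed_zero_count_def by (intro sum.cong refl) (simp add: J[OF h])
    finally show ?thesis .
  qed
  have C1C: "C1_map ?S (C h)" if "C1_map S h" for h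
    unfolding C_def
    by (rule C1_map_compose[OF C1_map_compose[OF C1_map_bounded_linear[OF bounded_linear_of_vec] that]
        C1_map_bounded_linear[OF bounded_linear_to_vec, of UNIV]]) auto
  have contC: "continuous_on (closure ?S) (C h)" if "continuous_on (closure S) h" for h
    unfolding C_def cl
    by (rule continuous_on_compose2[OF linear_continuous_on[OF bounded_linear_to_vec, of UNIV]
        continuous_on_compose2[OF that linear_continuous_on[OF bounded_linear_of_vec]]]) auto
  have regC: "Jdet (C h) v \<noteq> 0" if "C1_map S h" "regular_value_zero S h" "v \<in> ?S" "C h v = 0" for h v
    using that by (auto simp: J C_def to0 regular_value_zero_def)
  have "(\<Sum>v\<in>{v\<in>?S. C h0 v = 0}. sgn (Jdet (C h0) v)) = (\<Sum>v\<in>{v\<in>?S. C h1 v = 0}. sgn (Jdet (C h1) v))"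
  proof (rule signed_zero_count_homotopy_vec[OF oS _ C1C[OF C1(1)] C1C[OF C1(2)] contC[OF cont(1)] contC[OF cont(2)]])
    show "bounded ?S" using bounded_linear_image[OF S(2) bounded_linear_to_vec] .
    show "Jdet (C h0) v \<noteq> 0" if "v \<in> ?S" "C h0 v = 0" for v by (rule regC[OF C1(1) reg(1) that])
    show "Jdet (C h1) v \<noteq> 0" if "v \<in> ?S" "C h1 v = 0" for v by (rule regC[OF C1(2) reg(2) that])
    fix t :: real and v assume t: "0 \<le> t" "t \<le> 1" and v: "v \<in> frontier ?S"
    have "(1 - t) *\<^sub>R C h0 v + t *\<^sub>R C h1 v = to_vec ((1 - t) *\<^sub>R h0 (of_vec v) + t *\<^sub>R h1 (of_vec v))"
      by (simp add: C_def linear_add[OF linear_to_vec] linear_scale[OF linear_to_vec])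
    then show "(1 - t) *\<^sub>R C h0 v + t *\<^sub>R C h1 v \<noteq> 0"
      using nz[OF t fr[OF v]] by (simp add: to0)
  qed
  then show ?thesis by (simp add: count C1)
qed

text \<open>By Sard's theorem the critical values are negligible, while a ball is not; some
  \<open>c\<close> in the ball is therefore regular, and subtracting it leaves the derivative
  unchanged.\<close>

lemma exists_small_regular_value:
  fixes p :: "'a::euclidean_space \<Rightarrow> 'a"
  assumes p: "C1_map UNIV p" and "e > 0"
  obtains c where "norm c < e" "\<And>S. regular_value_zero S (\<lambda>x. p x - c)"
proof -
  define q where "q v = to_vec (p (of_vec v))" for v
  have der: "(q has_derivative (\<lambda>v. to_vec (frechet_derivative p (at (of_vec u)) (of_vec v)))) (at u)" for u
  proof -
    have "((\<lambda>v. p (of_vec v)) has_derivative (\<lambda>v. frechet_derivative p (at (of_vec u)) (of_vec v))) (at u)"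
      by (rule has_derivative_compose[OF bounded_linear_imp_has_derivative[OF bounded_linear_of_vec]
          C1_map_has_derivative[OF p UNIV_I]])
    from bounded_linear.has_derivative[OF bounded_linear_to_vec this] show ?thesis
      unfolding q_def .
  qed
  let ?Crit = "{u. jacobian p (of_vec u) = 0}"
  have "negligible (q ` ?Crit)"
  proof (rule baby_Sard[OF order_refl has_derivative_at_withinI[OF der]])
    fix u assume "u \<in> ?Crit"
    then show "rank (matrix (\<lambda>v. to_vec (frechet_derivative p (at (of_vec u)) (of_vec v)))) < CARD('a basis_index)"
      unfolding det_eq_0_rank[symmetric] by (simp add: jacobian_def endo_det_eq_det)
  qed
  moreover have "\<not> negligible (to_vec ` ball (0::'a) e)"
    using \<open>e > 0\<close> by (intro open_not_negligible open_to_vec_image) auto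
  ultimately have "\<not> to_vec ` ball (0::'a) e \<subseteq> q ` ?Crit"
    using negligible_subset by blast
  then obtain c where c: "c \<in> ball 0 e" "to_vec c \<notin> q ` ?Crit" by blast
  show ?thesis
  proof (rule that)
    show "norm c < e" using c by simp
    show "regular_value_zero S (\<lambda>x. p x - c)" for S
      unfolding regular_value_zero_def
    proof (intro ballI impI notI)
      fix x assume x: "p x - c = 0" "jacobian (\<lambda>x. p x - c) x = 0"
      have "((\<lambda>x. p x - c) has_derivative frechet_derivative p (at x)) (at x)"
        using has_derivative_diff[OF C1_map_has_derivative[OF p UNIV_I] has_derivative_const, of c] by simp
      from frechet_derivative_at[OF this] have "jacobian p x = 0"
        using x(2) by (simp add: jacobian_def)
      then have "to_vec c \<in> q ` ?Crit"
        using x(1) by (intro image_eqI[of _ _ "to_vec x"]) (auto simp: q_def)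
      then show False using c(2) by blast
    qed
  qed
qed


section \<open>The local degree\<close>

text \<open>The determinant of a block triangular matrix. A permutation moving some point of
  \<open>A\<close> into \<open>B\<close> contributes 0; the others are exactly the products of a
  permutation of \<open>A\<close> with one of \<open>B\<close>.\<close>

lemma leibniz_sum_disjoint_Un:
  assumes fin: "finite A" "finite B" and disj: "A \<inter> B = {}"
    and zero: "\<And>a b. a \<in> A \<Longrightarrow> b \<in> B \<Longrightarrow> M a b = 0"
  shows "leibniz_sum (A \<union> B) M = leibniz_sum A M * leibniz_sum B M"
proof -
  let ?t = "\<lambda>C p. of_int (sign p) * (\<Prod>c\<in>C. M c (p c)) :: real"
  let ?P = "{p. p permutes A \<union> B \<and> p ` A \<subseteq> A}"
  have bij: "bij_betw (\<lambda>(p, q). p \<circ> q) ({p. p permutes A} \<times> {q. q permutes B}) ?P"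
  proof (rule bij_betw_byWitness[of _ "\<lambda>p. (\<lambda>x. if x \<in> A then p x else x, \<lambda>x. if x \<in> B then p x else x)"])
    have fixA: "q x = x" if "q permutes B" "x \<in> A" for q x
    proof -
      have "x \<notin> B" using that(2) disj by blast
      then show ?thesis by (rule permutes_not_in[OF that(1)])
    qed
    have fixB: "p (q y) = q y" if "p permutes A" "q permutes B" "y \<in> B" for p q y
    proof -
      have "q y \<in> B" using permutes_in_image[OF that(2)] that(3) by simp
      then have "q y \<notin> A" using disj by blast
      then show ?thesis by (rule permutes_not_in[OF that(1)])
    qed
    have split: "(\<lambda>x. if x \<in> A then p (q x) else x) = p" "(\<lambda>x. if x \<in> B then p (q x) else x) = q"
      if pq: "p permutes A" "q permutes B" for p q
      using fixA[OF pq(2)] fixB[OF pq] permutes_not_in[OF pq(1)] permutes_not_in[OF pq(2)]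
      by (simp_all add: fun_eq_iff)
    show "\<forall>pq\<in>{p. p permutes A} \<times> {q. q permutes B}.
        (\<lambda>x. if x \<in> A then (\<lambda>(p, q). p \<circ> q) pq x else x, \<lambda>x. if x \<in> B then (\<lambda>(p, q). p \<circ> q) pq x else x) = pq"
    proof
      fix pq assume "pq \<in> {p. p permutes A} \<times> {q. q permutes B}"
      then obtain p q where pq: "pq = (p, q)" "p permutes A" "q permutes B" by blast
      show "(\<lambda>x. if x \<in> A then (\<lambda>(p, q). p \<circ> q) pq x else x, \<lambda>x. if x \<in> B then (\<lambda>(p, q). p \<circ> q) pq x else x) = pq"
        unfolding pq(1) prod.case o_apply split[OF pq(2,3)] by (rule refl)
    qed
    show "(\<lambda>(p, q). p \<circ> q) ` ({p. p permutes A} \<times> {q. q permutes B}) \<subseteq> ?P"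
    proof (rule image_subsetI)
      fix pq assume "pq \<in> {p. p permutes A} \<times> {q. q permutes B}"
      then obtain p q where pq: "pq = (p, q)" "p permutes A" "q permutes B" by blast
      have "p \<circ> q permutes A \<union> B"
        by (rule permutes_compose[OF permutes_subset[OF pq(3)] permutes_subset[OF pq(2)]]) simp_all
      moreover have "(p \<circ> q) ` A \<subseteq> A"
        by (rule image_subsetI) (simp add: fixA[OF pq(3)] permutes_in_image[OF pq(2)])
      ultimately show "(\<lambda>(p, q). p \<circ> q) pq \<in> ?P" by (simp add: pq(1))
    qed
    have **: "(\<lambda>x. if x \<in> C then p x else x) permutes C" if "inj p" "p ` C \<subseteq> C" "finite C" for p and C :: "'a set"
    proof (rule bij_imp_permutes)
      have "p ` C = C" by (rule endo_inj_surj[OF that(3,2) inj_on_subset[OF that(1) subset_UNIV]])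
      then have "bij_betw p C C" using inj_on_subset[OF that(1) subset_UNIV] by (simp add: bij_betw_def)
      then show "bij_betw (\<lambda>x. if x \<in> C then p x else x) C C"
        by (rule bij_betw_cong[THEN iffD1, rotated]) simp
    qed simp
    \<comment> \<open>By finiteness \<open>p\<close> maps \<open>A\<close> onto itself, so
      injectivity leaves no room in \<open>A\<close> for images of \<open>B\<close>.\<close>
    have B: "p ` B \<subseteq> B" if p: "p \<in> ?P" for p
    proof -
      have pP: "p permutes A \<union> B" "p ` A \<subseteq> A" using p by auto
      have pA: "p ` A = A"
        by (rule endo_inj_surj[OF fin(1) pP(2) inj_on_subset[OF permutes_inj[OF pP(1)] subset_UNIV]])
      show ?thesis
      proof
        fix y assume "y \<in> p ` B"
        then obtain b where b: "b \<in> B" "y = p b" by blast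
        have "y \<notin> p ` A"
          using b disj inj_eq[OF permutes_inj[OF pP(1)]] by auto
        moreover have "y \<in> A \<union> B" using permutes_in_image[OF pP(1), of b] b by blast
        ultimately show "y \<in> B" using pA by blast
      qed
    qed
    show "\<forall>p\<in>?P. (\<lambda>(p, q). p \<circ> q) (\<lambda>x. if x \<in> A then p x else x, \<lambda>x. if x \<in> B then p x else x) = p"
    proof
      fix p assume p: "p \<in> ?P"
      have "(if (if x \<in> B then p x else x) \<in> A then p (if x \<in> B then p x else x) else (if x \<in> B then p x else x)) = p x" for x
      proof (cases "x \<in> B")
        case True
        then have "p x \<notin> A" using B[OF p] disj by blast
        then show ?thesis using True by simp
      next
        case False
        then show ?thesis using p permutes_not_in[of p "A \<union> B" x] by auto
      qed
      then show "(\<lambda>(p, q). p \<circ> q) (\<lambda>x. if x \<in> A then p x else x, \<lambda>x. if x \<in> B then p x else x) = p"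
        by (simp add: fun_eq_iff)
    qed
    show "(\<lambda>p. (\<lambda>x. if x \<in> A then p x else x, \<lambda>x. if x \<in> B then p x else x)) ` ?P
        \<subseteq> {p. p permutes A} \<times> {q. q permutes B}"
    proof (rule image_subsetI)
      fix p assume p: "p \<in> ?P"
      then have "inj p" "p ` A \<subseteq> A" using permutes_inj by blast+
      then show "(\<lambda>x. if x \<in> A then p x else x, \<lambda>x. if x \<in> B then p x else x) \<in> {p. p permutes A} \<times> {q. q permutes B}"
        using **[OF _ _ fin(1)] **[OF _ B[OF p] fin(2)] by simp
    qed
  qed
  have "leibniz_sum (A \<union> B) M = (\<Sum>p\<in>?P. ?t (A \<union> B) p)"
    unfolding leibniz_sum_def
  proof (rule sum.mono_neutral_right)
    show "finite {p. p permutes A \<union> B}" using fin by (simp add: finite_permutations)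
    show "\<forall>p\<in>{p. p permutes A \<union> B} - ?P. ?t (A \<union> B) p = 0"
    proof
      fix p assume p: "p \<in> {p. p permutes A \<union> B} - ?P"
      then obtain a where a: "a \<in> A" "p a \<notin> A" by blast
      then have "p a \<in> B" using p permutes_in_image[of p "A \<union> B" a] by auto
      then have "(\<Prod>c\<in>A \<union> B. M c (p c)) = 0"
        using zero a fin by (intro prod_zero) auto
      then show "?t (A \<union> B) p = 0" by simp
    qed
  qed auto
  also have "\<dots> = (\<Sum>(p, q)\<in>{p. p permutes A} \<times> {q. q permutes B}. ?t (A \<union> B) (p \<circ> q))"
    by (simp add: sum.reindex_bij_betw[OF bij, symmetric] case_prod_unfold)
  also have "\<dots> = (\<Sum>(p, q)\<in>{p. p permutes A} \<times> {q. q permutes B}. ?t A p * ?t B q)"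
  proof (rule sum.cong[OF refl], clarsimp)
    fix p q assume pq: "p permutes A" "q permutes B"
    have "sign (p \<circ> q) = sign p * sign q"
      using pq fin by (intro sign_compose) (auto simp: permutation_permutes)
    moreover have "(\<Prod>c\<in>A. M c (p (q c))) = (\<Prod>c\<in>A. M c (p c))"
      using disj by (intro prod.cong refl) (metis disjoint_iff permutes_not_in[OF pq(2)])
    moreover have "(\<Prod>c\<in>B. M c (p (q c))) = (\<Prod>c\<in>B. M c (q c))"
      using disj by (intro prod.cong refl) (metis disjoint_iff permutes_in_image[OF pq(2)] permutes_not_in[OF pq(1)])
    ultimately show "of_int (sign (p \<circ> q)) * (\<Prod>c\<in>A \<union> B. M c (p (q c))) =
        of_int (sign p) * (\<Prod>c\<in>A. M c (p c)) * (of_int (sign q) * (\<Prod>c\<in>B. M c (q c)))"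
      by (simp add: prod.union_disjoint[OF fin disj])
  qed
  also have "\<dots> = leibniz_sum A M * leibniz_sum B M"
    by (simp add: leibniz_sum_def sum_product sum.cartesian_product)
  finally show ?thesis .
qed

text \<open>The basis of the product consists of the vectors \<open>(u, 0)\<close> and
  \<open>(0, v)\<close>; the mixed entries \<open>(L1 u, L2 0) \<bullet> (0, v)\<close> vanish
  because of the value at 0.\<close>

lemma endo_det_prod:
  fixes L1 :: "'a::euclidean_space \<Rightarrow> 'a" and L2 :: "'b::euclidean_space \<Rightarrow> 'b"
  assumes "L1 0 = 0" "L2 0 = 0"
  shows "endo_det (\<lambda>z. (L1 (fst z), L2 (snd z))) = endo_det L1 * endo_det L2"
proof -
  let ?A = "(\<lambda>u. (u, 0 :: 'b)) ` (Basis :: 'a set)" and ?B = "(\<lambda>v. (0 :: 'a, v)) ` (Basis :: 'b set)"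
  let ?M = "\<lambda>b c. (L1 (fst b), L2 (snd b)) \<bullet> c"
  have "endo_det (\<lambda>z. (L1 (fst z), L2 (snd z))) = leibniz_sum (?A \<union> ?B) ?M"
    by (simp add: endo_det_eq_leibniz_sum Basis_prod_def)
  also have "\<dots> = leibniz_sum ?A ?M * leibniz_sum ?B ?M"
    by (rule leibniz_sum_disjoint_Un) (auto simp: assms)
  also have "leibniz_sum ?A ?M = endo_det L1"
    unfolding endo_det_eq_leibniz_sum
    by (subst leibniz_sum_reindex[of Basis "\<lambda>u. (u, 0)"]) (auto simp: bij_betw_def inj_on_def)
  also have "leibniz_sum ?B ?M = endo_det L2"
    unfolding endo_det_eq_leibniz_sum
    by (subst leibniz_sum_reindex[of Basis "\<lambda>v. (0, v)"]) (auto simp: bij_betw_def inj_on_def)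
  finally show ?thesis .
qed

section \<open>Existence and comparison of approximations\<close>

lemma compact_open_neighbourhood:
  fixes K V :: "'a::euclidean_space set"
  assumes "compact K" "open V" "K \<subseteq> V"
  obtains S where "open S" "bounded S" "K \<subseteq> S" "closure S \<subseteq> V"
proof -
  obtain c :: "'a \<Rightarrow> real" and N T where N: "open N" "K \<subseteq> N" and T: "compact T" "N \<subseteq> T" "T \<subseteq> V"
    using C1_cutoff[OF assms] by metis
  have "closure N \<subseteq> V"
    using closure_minimal[OF T(2) compact_imp_closed[OF T(1)]] T(3) by blast
  then show ?thesis
    using that[OF N(1) bounded_subset[OF compact_imp_bounded[OF T(1)] T(2)] N(2)] by blast
qed

text \<open>A polynomial from Stone-Weierstrass, shifted by a small regular value, each using half
  of \<open>e\<close>. Regularity holds on every set at once, so one approximation can serve two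
  domains.\<close>

lemma regular_C1_approximation:
  fixes g :: "'a::euclidean_space \<Rightarrow> 'a"
  assumes "compact C" "continuous_on C g" "e > 0"
  obtains h where "C1_map UNIV h" "\<And>S. regular_value_zero S h" "\<And>x. x \<in> C \<Longrightarrow> norm (h x - g x) < e"
proof -
  obtain p where p: "polynomial_function p" "\<forall>x\<in>C. norm (g x - p x) < e / 2"
    using Stone_Weierstrass_polynomial_function[OF assms(1,2), of "e / 2"] assms(3) by auto
  have C1p: "C1_map UNIV p" by (rule C1_map_polynomial[OF p(1)])
  obtain c where c: "norm c < e / 2" "\<And>S. regular_value_zero S (\<lambda>x. p x - c)"
    using exists_small_regular_value[OF C1p, of "e / 2"] assms(3) by (metis half_gt_zero)
  show ?thesis
  proof (rule that[of "\<lambda>x. p x - c"])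
    show "C1_map UNIV (\<lambda>x. p x - c)" by (intro C1_map_diff C1p C1_map_const)
    fix x assume "x \<in> C"
    then have "norm (g x - p x) < e / 2" using p(2) by blast
    then have "norm (p x - g x) + norm c < e" using c(1) by (simp add: norm_minus_commute)
    moreover have "norm (p x - c - g x) \<le> norm (p x - g x) + norm c"
      using norm_triangle_ineq4[of "p x - g x" c] by (simp add: algebra_simps)
    ultimately show "norm (p x - c - g x) < e" by linarith
  qed (rule c(2))
qed

lemma degree_approximationI:
  assumes "open S" "bounded S" "{x\<in>V. g x = 0} \<subseteq> S" "closure S \<subseteq> V"
    and "C1_map UNIV h" "regular_value_zero S h"
    and "\<And>x. x \<in> closure S \<Longrightarrow> norm (h x - g x) < e"
    and "\<And>y. y \<in> frontier S \<Longrightarrow> e \<le> norm (g y)"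
  shows "degree_approximation g V S h"
proof -
  have "norm (h x - g x) < norm (g y)" if "x \<in> closure S" "y \<in> frontier S" for x y
    using assms(7)[OF that(1)] assms(8)[OF that(2)] by linarith
  moreover have "continuous_on (closure S) h"
    using C1_map_continuous_on[OF assms(5)] continuous_on_subset by blast
  moreover have "C1_on S h"
    unfolding C1_on_eq_C1_map using C1_map_subset[OF assms(5)] by blast
  ultimately show ?thesis
    using assms(1-4,6) unfolding degree_approximation_def by blast
qed

lemma frontier_lower_bound:
  fixes g :: "'a::euclidean_space \<Rightarrow> 'b::real_normed_vector"
  assumes "open S" "bounded S" "{x\<in>V. g x = 0} \<subseteq> S" "closure S \<subseteq> V" "continuous_on V g"
  obtains m where "m > 0" "\<And>y. y \<in> frontier S \<Longrightarrow> m \<le> norm (g y)"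
proof (rule pos_lower_bound_on_compact[of "frontier S" g])
  have fV: "frontier S \<subseteq> V" using assms(4) by (auto simp: frontier_def)
  show "compact (frontier S)" by (rule compact_frontier_bounded[OF assms(2)])
  show "continuous_on (frontier S) g" by (rule continuous_on_subset[OF assms(5) fV])
  show "g x \<noteq> 0" if "x \<in> frontier S" for x
    using that fV assms(1,3) by (auto simp: frontier_def interior_open)
qed (rule that)

text \<open>The free tolerance \<open>e\<close> is for products, where the errors of the factors add
  up.\<close>

lemma exists_degree_approximation:
  fixes g :: "'a::euclidean_space \<Rightarrow> 'a"
  assumes S: "open S" "bounded S" "{x\<in>V. g x = 0} \<subseteq> S" "closure S \<subseteq> V" "continuous_on V g" and "e > 0"
  obtains h where "degree_approximation g V S h" "C1_map UNIV h" "regular_value_zero S h"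
    "\<And>x. x \<in> closure S \<Longrightarrow> norm (h x - g x) < e"
proof -
  obtain m where m: "m > 0" "\<And>y. y \<in> frontier S \<Longrightarrow> m \<le> norm (g y)"
    using frontier_lower_bound[OF S] by blast
  have "compact (closure S)" using S(2) by simp
  then obtain h where h: "C1_map UNIV h" "\<And>S. regular_value_zero S h"
    "\<And>x. x \<in> closure S \<Longrightarrow> norm (h x - g x) < min m e"
    using regular_C1_approximation[OF _ continuous_on_subset[OF S(5,4)], of "min m e"] m(1) \<open>e > 0\<close> by auto
  have "degree_approximation g V S h"
    by (rule degree_approximationI[OF S(1-4) h(1,2,3)]) (use m(2) in force)+
  then show ?thesis using that h by simp
qed

text \<open>At a frontier point both values lie in the open ball of radius \<open>norm (g x)\<close>
  around \<open>g x\<close>; it is convex and misses 0, so the linear homotopy has no zero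
  there.\<close>

lemma signed_zero_count_eq_same_domain:
  assumes "degree_approximation g V S h" "degree_approximation g V S h'"
  shows "signed_zero_count S h = signed_zero_count S h'"
proof (rule signed_zero_count_homotopy)
  fix t :: real and x assume t: "0 \<le> t" "t \<le> 1" and x: "x \<in> frontier S"
  then have cl: "x \<in> closure S" by (simp add: frontier_def)
  have n: "norm (h x - g x) < norm (g x)" "norm (h' x - g x) < norm (g x)"
    using assms cl x by (auto simp: degree_approximation_def)
  show "(1 - t) *\<^sub>R h x + t *\<^sub>R h' x \<noteq> 0"
  proof
    assume "(1 - t) *\<^sub>R h x + t *\<^sub>R h' x = 0"
    then have "- g x = (1 - t) *\<^sub>R (h x - g x) + t *\<^sub>R (h' x - g x)" by (simp add: algebra_simps)
    then have "norm (g x) = norm ((1 - t) *\<^sub>R (h x - g x) + t *\<^sub>R (h' x - g x))" by (metis norm_minus_cancel)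
    also have "\<dots> \<le> (1 - t) * norm (h x - g x) + t * norm (h' x - g x)"
      using norm_triangle_ineq[of "(1 - t) *\<^sub>R (h x - g x)" "t *\<^sub>R (h' x - g x)"] t by simp
    also have "\<dots> < norm (g x)" by (rule convex_bound_lt[OF n]) (use t in auto)
    finally show False by simp
  qed
qed (use assms in \<open>auto simp: degree_approximation_def C1_on_eq_C1_map\<close>)

text \<open>A single \<open>k\<close>, closer to \<open>g\<close> on both closures than the minimum
  of \<open>norm (g x)\<close> off \<open>S \<inter> S'\<close>, is an approximation over
  \<open>S\<close> and over \<open>S'\<close>. All its zeros lie in the intersection, so its two
  counts coincide.\<close>

lemma signed_zero_count_unique:
  assumes g: "continuous_on V g" and h: "degree_approximation g V S h" "degree_approximation g V S' h'"
  shows "signed_zero_count S h = signed_zero_count S' h'"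
proof -
  have S: "open S" "bounded S" "{x\<in>V. g x = 0} \<subseteq> S" "closure S \<subseteq> V"
    and S': "open S'" "bounded S'" "{x\<in>V. g x = 0} \<subseteq> S'" "closure S' \<subseteq> V"
    using h by (auto simp: degree_approximation_def)
  let ?C = "(closure S \<union> closure S') - (S \<inter> S')"
  have comp: "compact (closure S \<union> closure S')" using S(2) S'(2) by (intro compact_Un) auto
  have sub: "closure S \<union> closure S' \<subseteq> V" using S(4) S'(4) by blast
  have "compact ?C" using comp S(1) S'(1) by (intro compact_diff) auto
  moreover have "continuous_on ?C g" using continuous_on_subset[OF g] sub by blast
  moreover have "g x \<noteq> 0" if "x \<in> ?C" for x using that sub S(3) S'(3) by blast
  ultimately obtain m where m: "m > 0" "\<And>x. x \<in> ?C \<Longrightarrow> m \<le> norm (g x)"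
    using pos_lower_bound_on_compact[of ?C g] by blast
  obtain k where k: "C1_map UNIV k" "\<And>S. regular_value_zero S k"
    "\<And>x. x \<in> closure S \<union> closure S' \<Longrightarrow> norm (k x - g x) < m"
    using regular_C1_approximation[OF comp continuous_on_subset[OF g sub] m(1)] by blast
  have fr: "frontier S \<subseteq> ?C" "frontier S' \<subseteq> ?C"
    using S(1) S'(1) by (auto simp: frontier_def interior_open)
  have a: "degree_approximation g V S k"
    by (rule degree_approximationI[OF S k(1,2), of m]) (use k(3) m(2) fr in auto)
  have a': "degree_approximation g V S' k"
    by (rule degree_approximationI[OF S' k(1,2), of m]) (use k(3) m(2) fr in auto)
  have "{x\<in>S. k x = 0} = {x\<in>S'. k x = 0}"
  proof -
    have "k x \<noteq> 0" if "x \<in> ?C" for x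
      using m(2)[OF that] k(3)[of x] that by auto
    then show ?thesis using closure_subset[of S] closure_subset[of S'] by blast
  qed
  then have "signed_zero_count S k = signed_zero_count S' k"
    by (simp only: signed_zero_count_def)
  then show ?thesis
    using signed_zero_count_eq_same_domain[OF h(1) a] signed_zero_count_eq_same_domain[OF h(2) a']
    by simp
qed

section \<open>The degree as a number: locality and homotopy invariance\<close>

lemma signed_zero_count_Ints: "signed_zero_count S h \<in> \<int>"
  unfolding signed_zero_count_def by (rule Ints_sum) (simp add: sgn_if)

text \<open>The approximation in hand pins the description down: if there were none, every integer
  would satisfy it vacuously.\<close>

lemma local_degree_eq:
  assumes g: "continuous_on V g" and h: "degree_approximation g V S h"
  shows "of_int (local_degree g V) = signed_zero_count S h"
proof -
  obtain d :: int where d: "signed_zero_count S h = of_int d"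
    using signed_zero_count_Ints Ints_cases by metis
  have "local_degree g V = d"
    unfolding local_degree_def
  proof (rule the_equality)
    show "\<forall>S h. degree_approximation g V S h \<longrightarrow> signed_zero_count S h = of_int d"
      using signed_zero_count_unique[OF g _ h] d by simp
    show "e = d" if "\<forall>S h. degree_approximation g V S h \<longrightarrow> signed_zero_count S h = of_int e" for e
      using that h d by force
  qed
  then show ?thesis using d by simp
qed

text \<open>Excision: apart from the location of the zeros, an approximation over \<open>S\<close>
  sees the function only on \<open>closure S\<close>, so it serves both functions.\<close>

lemma local_degree_cong:
  assumes g: "continuous_on V g" "continuous_on V' g'"
    and S: "open S" "bounded S" "closure S \<subseteq> V" "closure S \<subseteq> V'"
    and eq: "\<And>x. x \<in> closure S \<Longrightarrow> g x = g' x"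
    and zeros: "{x\<in>V. g x = 0} \<subseteq> S" "{x\<in>V'. g' x = 0} \<subseteq> S"
  shows "local_degree g V = local_degree g' V'"
proof -
  obtain h where h: "degree_approximation g V S h"
    using exists_degree_approximation[OF S(1,2) zeros(1) S(3) g(1), of 1] zero_less_one by blast
  have fr: "g y = g' y" if "y \<in> frontier S" for y using eq that by (simp add: frontier_def)
  have "degree_approximation g' V' S h"
    using h S(4) zeros(2) eq fr unfolding degree_approximation_def by simp
  then show ?thesis
    using local_degree_eq[OF g(1) h] local_degree_eq[OF g(2)] by (metis of_int_eq_iff)
qed

text \<open>Uniform continuity on a compact product makes nearby stages so close that they share an
  approximation.\<close>

lemma local_degree_homotopy:
  fixes G :: "real \<Rightarrow> 'a::euclidean_space \<Rightarrow> 'a"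
  assumes G: "continuous_on ({0..1} \<times> V) (\<lambda>p. G (fst p) (snd p))"
    and S: "open S" "bounded S" "closure S \<subseteq> V"
    and zeros: "\<And>t x. t \<in> {0..1} \<Longrightarrow> x \<in> V \<Longrightarrow> G t x = 0 \<Longrightarrow> x \<in> S"
  shows "local_degree (G 0) V = local_degree (G 1) V"
proof -
  let ?G = "\<lambda>p. G (fst p) (snd p)"
  let ?P = "{0..1::real} \<times> closure S"
  have fV: "frontier S \<subseteq> V" using S(3) by (auto simp: frontier_def)
  have nz: "?G p \<noteq> 0" if "p \<in> {0..1} \<times> frontier S" for p
    using that zeros[of "fst p" "snd p"] fV S(1) by (auto simp: frontier_def interior_open)
  have compF: "compact ({0..1::real} \<times> frontier S)"
    by (intro compact_Times compact_Icc compact_frontier_bounded S(2))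
  have contF: "continuous_on ({0..1} \<times> frontier S) ?G"
    by (rule continuous_on_subset[OF G]) (use fV in auto)
  obtain m where m: "m > 0" "\<And>p. p \<in> {0..1} \<times> frontier S \<Longrightarrow> m \<le> norm (?G p)"
    using pos_lower_bound_on_compact[OF compF contF nz] by blast
  have "compact ?P" using S(2) by (intro compact_Times) auto
  moreover have "continuous_on ?P ?G"
    by (rule continuous_on_subset[OF G]) (use S(3) in auto)
  ultimately have uc: "uniformly_continuous_on ?P ?G" by (rule compact_uniformly_continuous[rotated])
  \<comment> \<open>Half of \<open>m\<close> is spent on approximating \<open>G s\<close>, the other
    half on moving from \<open>s\<close> to \<open>t\<close>.\<close>
  have m2: "0 < m / 2" using m(1) by simp
  from mp[OF spec[OF uc[unfolded uniformly_continuous_on_def]] m2] obtain d where d: "d > 0"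
    "\<forall>p\<in>?P. \<forall>q\<in>?P. dist q p < d \<longrightarrow> dist (?G q) (?G p) < m / 2"
    by blast
  have contG: "continuous_on V (G t)" if "t \<in> {0..1}" for t
  proof -
    have "continuous_on V (\<lambda>x. ?G (t, x))"
      by (rule continuous_on_compose2[OF G]) (use that in \<open>auto intro!: continuous_intros\<close>)
    then show ?thesis by simp
  qed
  have step: "local_degree (G s) V = local_degree (G t) V"
    if st: "s \<in> {0..1}" "t \<in> {0..1}" "\<bar>s - t\<bar> < d" for s t
  proof -
    have comp: "compact (closure S)" using S(2) by simp
    obtain h where h: "C1_map UNIV h" "\<And>S. regular_value_zero S h"
      "\<And>x. x \<in> closure S \<Longrightarrow> norm (h x - G s x) < m / 2"
      using regular_C1_approximation[OF comp continuous_on_subset[OF contG[OF st(1)] S(3)] m2] by blast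
    have h': "norm (h x - G t x) < m" if x: "x \<in> closure S" for x
    proof -
      have "dist (t, x) (s, x) < d" using st(3) by (simp add: dist_Pair_Pair dist_real_def abs_minus_commute)
      then have "dist (G t x) (G s x) < m / 2"
        using bspec[OF bspec[OF d(2), of "(s, x)"], of "(t, x)"] st x by simp
      then have "norm (G s x - G t x) < m / 2" by (simp add: dist_norm norm_minus_commute)
      then show ?thesis
        using h(3)[OF x] norm_triangle_ineq[of "h x - G s x" "G s x - G t x"] by simp
    qed
    have h0: "norm (h x - G s x) < m" if "x \<in> closure S" for x
      using h(3)[OF that] m(1) by simp
    have "degree_approximation (G s) V S h"
      by (rule degree_approximationI[OF S(1,2) _ S(3) h(1,2) h0]) (use zeros st m(2) in force)+
    moreover have "degree_approximation (G t) V S h"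
      by (rule degree_approximationI[OF S(1,2) _ S(3) h(1,2) h']) (use zeros st m(2) in force)+
    ultimately show ?thesis
      using local_degree_eq[OF contG[OF st(1)]] local_degree_eq[OF contG[OF st(2)]]
      by (metis of_int_eq_iff)
  qed
  obtain n :: nat where n: "n > 0" "1 / real n < d"
    using d(1) by (metis nat_approx_posE zero_less_Suc of_nat_Suc add.commute)
  have "local_degree (G (real k / real n)) V = local_degree (G 0) V" if "k \<le> n" for k
    using that
  proof (induction k)
    case (Suc k)
    have "local_degree (G (real k / real n)) V = local_degree (G (real (Suc k) / real n)) V"
    proof (rule step)
      have "real k / real n - real (Suc k) / real n = - (1 / real n)"
        by (simp add: diff_divide_distrib[symmetric])
      then show "\<bar>real k / real n - real (Suc k) / real n\<bar> < d" using n(2) by simp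
    qed (use Suc.prems n(1) in \<open>auto simp: divide_le_eq\<close>)
    then show ?case using Suc by simp
  qed simp
  from this[of n] show ?thesis using n(1) by simp
qed


section \<open>The fixed point index\<close>

lemma C1_map_prod:
  fixes h1 :: "'a::euclidean_space \<Rightarrow> 'a" and h2 :: "'b::euclidean_space \<Rightarrow> 'b"
  assumes "C1_map UNIV h1" "C1_map UNIV h2"
  shows "C1_map UNIV (\<lambda>z. (h1 (fst z), h2 (snd z)))"
    and "\<And>z. jacobian (\<lambda>z. (h1 (fst z), h2 (snd z))) z = jacobian h1 (fst z) * jacobian h2 (snd z)"
proof -
  let ?D = "\<lambda>z v. (frechet_derivative h1 (at (fst z)) (fst v), frechet_derivative h2 (at (snd z)) (snd v))"
  have d1: "((\<lambda>z. h1 (fst z)) has_derivative (\<lambda>v. frechet_derivative h1 (at (fst z)) (fst v))) (at z)" for z :: "'a \<times> 'b"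
    by (rule has_derivative_compose[OF bounded_linear_imp_has_derivative[OF bounded_linear_fst]
        C1_map_has_derivative[OF assms(1) UNIV_I]])
  have d2: "((\<lambda>z. h2 (snd z)) has_derivative (\<lambda>v. frechet_derivative h2 (at (snd z)) (snd v))) (at z)" for z :: "'a \<times> 'b"
    by (rule has_derivative_compose[OF bounded_linear_imp_has_derivative[OF bounded_linear_snd]
        C1_map_has_derivative[OF assms(2) UNIV_I]])
  have D: "((\<lambda>z. (h1 (fst z), h2 (snd z))) has_derivative ?D z) (at z)" for z
    by (rule has_derivative_Pair[OF d1 d2])
  show "C1_map UNIV (\<lambda>z. (h1 (fst z), h2 (snd z)))"
  proof (rule C1_mapI[OF D])
    show "continuous_on UNIV (\<lambda>z. ?D z v)" for v
      by (intro continuous_on_Pair continuous_on_compose2[OF C1_map_continuous_derivative[OF assms(1)]]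
          continuous_on_compose2[OF C1_map_continuous_derivative[OF assms(2)]]
          continuous_on_fst continuous_on_snd continuous_on_id subset_UNIV)
  qed
  fix z
  have "linear (frechet_derivative h1 (at (fst z)))" "linear (frechet_derivative h2 (at (snd z)))"
    using C1_map_has_derivative[OF assms(1) UNIV_I] C1_map_has_derivative[OF assms(2) UNIV_I]
      has_derivative_linear by blast+
  then show "jacobian (\<lambda>z. (h1 (fst z), h2 (snd z))) z = jacobian h1 (fst z) * jacobian h2 (snd z)"
    unfolding jacobian_def frechet_derivative_at[OF D, symmetric]
    by (intro endo_det_prod linear_0)
qed

lemma local_degree_prod:
  fixes g1 :: "'a::euclidean_space \<Rightarrow> 'a" and g2 :: "'b::euclidean_space \<Rightarrow> 'b"
  assumes V1: "open V1" "continuous_on V1 g1" "compact {x\<in>V1. g1 x = 0}"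
    and V2: "open V2" "continuous_on V2 g2" "compact {x\<in>V2. g2 x = 0}"
  shows "local_degree (\<lambda>z. (g1 (fst z), g2 (snd z))) (V1 \<times> V2) = local_degree g1 V1 * local_degree g2 V2"
proof -
  let ?g = "\<lambda>z. (g1 (fst z), g2 (snd z))"
  obtain S1 where S1: "open S1" "bounded S1" "{x\<in>V1. g1 x = 0} \<subseteq> S1" "closure S1 \<subseteq> V1"
    using compact_open_neighbourhood[OF V1(3,1)] by blast
  obtain S2 where S2: "open S2" "bounded S2" "{x\<in>V2. g2 x = 0} \<subseteq> S2" "closure S2 \<subseteq> V2"
    using compact_open_neighbourhood[OF V2(3,1)] by blast
  obtain m1 where m1: "m1 > 0" "\<And>y. y \<in> frontier S1 \<Longrightarrow> m1 \<le> norm (g1 y)"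
    using frontier_lower_bound[OF S1 V1(2)] by blast
  obtain m2 where m2: "m2 > 0" "\<And>y. y \<in> frontier S2 \<Longrightarrow> m2 \<le> norm (g2 y)"
    using frontier_lower_bound[OF S2 V2(2)] by blast
  \<comment> \<open>Errors below \<open>e\<close> in each factor give an error below
    \<open>2 * e\<close> for the pair, and \<open>2 * e\<close> is at most both frontier
    bounds.\<close>
  define e where "e = min m1 m2 / 2"
  have e: "e > 0" "2 * e \<le> m1" "2 * e \<le> m2" using m1(1) m2(1) by (auto simp: e_def)
  obtain h1 where h1: "degree_approximation g1 V1 S1 h1" "C1_map UNIV h1" "regular_value_zero S1 h1"
    "\<And>x. x \<in> closure S1 \<Longrightarrow> norm (h1 x - g1 x) < e"
    using exists_degree_approximation[OF S1 V1(2) e(1)] by blast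
  obtain h2 where h2: "degree_approximation g2 V2 S2 h2" "C1_map UNIV h2" "regular_value_zero S2 h2"
    "\<And>x. x \<in> closure S2 \<Longrightarrow> norm (h2 x - g2 x) < e"
    using exists_degree_approximation[OF S2 V2(2) e(1)] by blast
  let ?h = "\<lambda>z. (h1 (fst z), h2 (snd z))"
  have zero: "(a, b) = 0 \<longleftrightarrow> a = 0 \<and> b = 0" for a :: 'a and b :: 'b by (simp add: zero_prod_def)
  have h: "degree_approximation ?g (V1 \<times> V2) (S1 \<times> S2) ?h"
  proof (rule degree_approximationI[where e = "2 * e"])
    show "open (S1 \<times> S2)" by (rule open_Times[OF S1(1) S2(1)])
    show "bounded (S1 \<times> S2)" by (rule bounded_Times[OF S1(2) S2(2)])
    show "{z \<in> V1 \<times> V2. ?g z = 0} \<subseteq> S1 \<times> S2" using S1(3) S2(3) by (auto simp: zero)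
    show "closure (S1 \<times> S2) \<subseteq> V1 \<times> V2" unfolding closure_Times using S1(4) S2(4) by (rule Sigma_mono)
    show "C1_map UNIV ?h" by (rule C1_map_prod(1)[OF h1(2) h2(2)])
    show "regular_value_zero (S1 \<times> S2) ?h"
      using h1(3) h2(3) by (auto simp: regular_value_zero_def zero C1_map_prod(2)[OF h1(2) h2(2)])
    show "norm (?h z - ?g z) < 2 * e" if "z \<in> closure (S1 \<times> S2)" for z
    proof -
      have "fst z \<in> closure S1" "snd z \<in> closure S2" using that by (auto simp: closure_Times)
      then have "norm (h1 (fst z) - g1 (fst z)) + norm (h2 (snd z) - g2 (snd z)) < 2 * e"
        using h1(4) h2(4) by fastforce
      then show ?thesis using norm_Pair_le[of "h1 (fst z) - g1 (fst z)" "h2 (snd z) - g2 (snd z)"] by simp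
    qed
    show "2 * e \<le> norm (?g z)" if "z \<in> frontier (S1 \<times> S2)" for z
    proof -
      \<comment> \<open>A frontier point of the product has a component on the frontier of its
        factor, and the norm of a pair dominates that of each component.\<close>
      have "fst z \<in> closure S1" "snd z \<in> closure S2" "fst z \<notin> S1 \<or> snd z \<notin> S2"
        using that unfolding frontier_def interior_open[OF open_Times[OF S1(1) S2(1)]] closure_Times
        by (auto simp: mem_Times_iff)
      then have "fst z \<in> frontier S1 \<or> snd z \<in> frontier S2"
        using S1(1) S2(1) by (auto simp: frontier_def interior_open)
      then have "2 * e \<le> norm (g1 (fst z)) \<or> 2 * e \<le> norm (g2 (snd z))"
        using m1(2) m2(2) e by (meson order_trans)
      moreover have "norm (g1 (fst z)) \<le> norm (?g z)" "norm (g2 (snd z)) \<le> norm (?g z)"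
        using norm_fst_le[of "g1 (fst z)" "g2 (snd z)"] norm_snd_le[of "g2 (snd z)" "g1 (fst z)"] by simp_all
      ultimately show ?thesis by linarith
    qed
  qed
  have contg: "continuous_on (V1 \<times> V2) ?g"
    by (intro continuous_on_Pair continuous_on_compose2[OF V1(2)] continuous_on_compose2[OF V2(2)]
        continuous_on_fst continuous_on_snd continuous_on_id) auto
  have "{z \<in> S1 \<times> S2. ?h z = 0} = {x\<in>S1. h1 x = 0} \<times> {x\<in>S2. h2 x = 0}"
    by (auto simp: zero)
  then have "signed_zero_count (S1 \<times> S2) ?h = signed_zero_count S1 h1 * signed_zero_count S2 h2"
    by (simp add: signed_zero_count_def C1_map_prod(2)[OF h1(2) h2(2)] sgn_mult sum_product
        sum.cartesian_product case_prod_unfold)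
  then have "(of_int (local_degree ?g (V1 \<times> V2)) :: real) = of_int (local_degree g1 V1 * local_degree g2 V2)"
    by (simp add: local_degree_eq[OF contg h] local_degree_eq[OF V1(2) h1(1)] local_degree_eq[OF V2(2) h2(1)])
  then show ?thesis by (simp only: of_int_eq_iff)
qed

text \<open>A zero is a value of \<open>f\<close>, so it lies in \<open>X\<close>, where
  \<open>r\<close> is the identity. Hence the zero set is the same for all retractions.\<close>

lemma retraction_displacement:
  fixes f :: "'a::euclidean_space \<Rightarrow> 'a"
  assumes f: "continuous_on X f" "f \<in> X \<rightarrow> X" and U: "openin (top_of_set X) U"
    and W: "open W" "retraction W X r"
  shows "open {x\<in>W. r x \<in> U}" "continuous_on {x\<in>W. r x \<in> U} (\<lambda>x. x - f (r x))"
    "{x\<in>{x\<in>W. r x \<in> U}. x - f (r x) = 0} = {x\<in>U. f x = x}"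
proof -
  have r: "X \<subseteq> W" "continuous_on W r" "r \<in> W \<rightarrow> X" "\<And>x. x \<in> X \<Longrightarrow> r x = x"
    using W(2) by (auto simp: retraction_def)
  obtain T where T: "open T" "U = X \<inter> T" using U by (auto simp: openin_open)
  have "{x\<in>W. r x \<in> U} = W \<inter> r -` T" using T(2) r(3) by auto
  then show "open {x\<in>W. r x \<in> U}"
    using continuous_open_preimage[OF r(2) W(1) T(1)] by simp
  have "continuous_on W (\<lambda>x. x - f (r x))"
    by (intro continuous_intros continuous_on_compose2[OF f(1) r(2)]) (use r(3) in auto)
  then show "continuous_on {x\<in>W. r x \<in> U} (\<lambda>x. x - f (r x))"
    by (rule continuous_on_subset) auto
  show "{x\<in>{x\<in>W. r x \<in> U}. x - f (r x) = 0} = {x\<in>U. f x = x}"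
  proof (rule set_eqI, rule iffI)
    fix x assume "x \<in> {x\<in>{x\<in>W. r x \<in> U}. x - f (r x) = 0}"
    then have x: "x \<in> W" "r x \<in> U" "x = f (r x)" by auto
    then have "x \<in> X" using T(2) f(2) by (metis Int_iff PiE)
    then show "x \<in> {x\<in>U. f x = x}" using x r(4)[of x] by simp
  next
    fix x assume "x \<in> {x\<in>U. f x = x}"
    then have x: "x \<in> U" "f x = x" "x \<in> X" using T(2) by auto
    then show "x \<in> {x\<in>{x\<in>W. r x \<in> U}. x - f (r x) = 0}" using r(1) r(4)[of x] by auto
  qed
qed

text \<open>The segment from \<open>r x\<close> to \<open>r' x\<close> may leave \<open>X\<close>,
  where \<open>f\<close> is not controlled, so \<open>r\<close> is applied once more; this requires
  the segment to stay in the domain of \<open>r\<close>. Excision restricts to an open set where it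
  does.\<close>

lemma local_degree_retraction_unique:
  fixes f :: "'a::euclidean_space \<Rightarrow> 'a"
  assumes f: "continuous_on X f" "f \<in> X \<rightarrow> X" and U: "openin (top_of_set X) U"
    and K: "compact {x\<in>U. f x = x}"
    and W: "open W" "retraction W X r" and W': "open W'" "retraction W' X r'"
  shows "local_degree (\<lambda>x. x - f (r x)) {x\<in>W. r x \<in> U} = local_degree (\<lambda>x. x - f (r' x)) {x\<in>W'. r' x \<in> U}"
proof -
  have r: "continuous_on W r" "r \<in> W \<rightarrow> X" "\<And>x. x \<in> X \<Longrightarrow> r x = x"
    and r': "continuous_on W' r'" "r' \<in> W' \<rightarrow> X" "\<And>x. x \<in> X \<Longrightarrow> r' x = x"
    using W(2) W'(2) by (auto simp: retraction_def)
  let ?K = "{x\<in>U. f x = x}"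
  let ?V0 = "{x\<in>W. r x \<in> U}" and ?V1 = "{x\<in>W'. r' x \<in> U}"
  note disp = retraction_displacement[OF f U W] and disp' = retraction_displacement[OF f U W']
  have UX: "U \<subseteq> X" using openin_imp_subset[OF U] .
  have KV: "?K \<subseteq> ?V0" "?K \<subseteq> ?V1" using disp(3) disp'(3) by blast+
  \<comment> \<open>Both end points in a common ball inside \<open>?V0\<close> keep the segment
    there by convexity, and a union over all such balls is open as a union of preimages.\<close>
  define B where "B = {(z, e). ball z e \<subseteq> ?V0}"
  define V where "V = (\<Union>(z, e)\<in>B. (?V0 \<inter> r -` ball z e) \<inter> (?V1 \<inter> r' -` ball z e))"
  have rV: "continuous_on ?V0 r" "continuous_on ?V1 r'"
    by (rule continuous_on_subset[OF r(1)], blast) (rule continuous_on_subset[OF r'(1)], blast)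
  have oV: "open V"
    unfolding V_def
    by (intro open_UN ballI, clarify) (intro open_Int continuous_open_preimage rV disp(1) disp'(1) open_ball)
  have VV: "V \<subseteq> ?V0" "V \<subseteq> ?V1" unfolding V_def by blast+
  have seg: "(1 - t) *\<^sub>R r x + t *\<^sub>R r' x \<in> ?V0" if t: "t \<in> {0..1}" and x: "x \<in> V" for t x
  proof -
    obtain z e where B: "ball z e \<subseteq> ?V0" "r x \<in> ball z e" "r' x \<in> ball z e"
      using x unfolding V_def B_def by blast
    have "(1 - t) *\<^sub>R r x + t *\<^sub>R r' x \<in> ball z e"
      by (rule convexD_alt[OF convex_ball B(2,3)]) (use t in auto)
    then show ?thesis using B(1) by blast
  qed
  have "?K \<subseteq> V"
  proof
    fix x assume x: "x \<in> ?K"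
    then have x0: "x \<in> ?V0" and x1: "x \<in> ?V1" using KV by blast+
    have "x \<in> X" using x UX by blast
    obtain e where e: "e > 0" "ball x e \<subseteq> ?V0"
      using openE[OF disp(1) x0] by blast
    have "r x \<in> ball x e" "r' x \<in> ball x e" using r(3)[OF \<open>x \<in> X\<close>] r'(3)[OF \<open>x \<in> X\<close>] e(1) by simp_all
    then have "x \<in> (?V0 \<inter> r -` ball x e) \<inter> (?V1 \<inter> r' -` ball x e)" using x0 x1 by blast
    moreover have "(x, e) \<in> B" using e(2) by (simp add: B_def)
    ultimately show "x \<in> V" unfolding V_def by blast
  qed
  then obtain S where S: "open S" "bounded S" "?K \<subseteq> S" "closure S \<subseteq> V"
    using compact_open_neighbourhood[OF K oV] by blast
  define G where "G t x = x - f (r ((1 - t) *\<^sub>R r x + t *\<^sub>R r' x))" for t x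
  have contG: "continuous_on ({0..1} \<times> V) (\<lambda>p. G (fst p) (snd p))"
  proof -
    have "continuous_on ({0..1} \<times> V) (\<lambda>p. (1 - fst p) *\<^sub>R r (snd p) + fst p *\<^sub>R r' (snd p))"
      by (intro continuous_intros continuous_on_compose2[OF rV(1)] continuous_on_compose2[OF rV(2)])
        (use VV in auto)
    then have "continuous_on ({0..1} \<times> V) (\<lambda>p. r ((1 - fst p) *\<^sub>R r (snd p) + fst p *\<^sub>R r' (snd p)))"
      by (rule continuous_on_compose2[OF rV(1)]) (use seg in auto)
    then have "continuous_on ({0..1} \<times> V) (\<lambda>p. f (r ((1 - fst p) *\<^sub>R r (snd p) + fst p *\<^sub>R r' (snd p))))"
      by (rule continuous_on_compose2[OF f(1)]) (use seg UX in force)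
    then show ?thesis unfolding G_def by (intro continuous_intros)
  qed
  \<comment> \<open>A zero lies in \<open>X\<close>, both retractions fix it, and the segment
    shrinks to the point itself.\<close>
  have Gzero: "x \<in> S" if t: "t \<in> {0..1}" and x: "x \<in> V" and z: "G t x = 0" for t x
  proof -
    have "r ((1 - t) *\<^sub>R r x + t *\<^sub>R r' x) \<in> X" using seg[OF t x] UX by blast
    moreover have xe: "x = f (r ((1 - t) *\<^sub>R r x + t *\<^sub>R r' x))" using z by (simp add: G_def)
    ultimately have "x \<in> X" using f(2) by (metis PiE)
    then have rx: "r x = x" "r' x = x" using r(3) r'(3) by auto
    then have "(1 - t) *\<^sub>R r x + t *\<^sub>R r' x = x" by (simp add: algebra_simps)
    then have "f x = x" using xe rx by simp
    moreover have "x \<in> U" using x VV(1) rx by auto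
    ultimately show ?thesis using S(3) by blast
  qed
  have cl: "closure S \<subseteq> ?V0" "closure S \<subseteq> ?V1" using S(4) VV by blast+
  have cG: "continuous_on V (G t)" if "t \<in> {0..1}" for t
  proof -
    have "continuous_on V (\<lambda>x. G (fst (t, x)) (snd (t, x)))"
      by (rule continuous_on_compose2[OF contG]) (use that in \<open>auto intro!: continuous_intros\<close>)
    then show ?thesis by simp
  qed
  have ends: "G 0 x = x - f (r x)" "G 1 x = x - f (r' x)" if x: "x \<in> V" for x
  proof -
    have "r x \<in> X" "r' x \<in> X" using x VV UX by blast+
    then show "G 0 x = x - f (r x)" "G 1 x = x - f (r' x)" by (simp_all add: G_def r(3))
  qed
  have "local_degree (\<lambda>x. x - f (r x)) ?V0 = local_degree (G 0) V"
  proof (rule local_degree_cong[OF disp(2) cG S(1,2) cl(1) S(4)])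
    show "x - f (r x) = G 0 x" if "x \<in> closure S" for x using ends(1) S(4) that by auto
    show "{x \<in> ?V0. x - f (r x) = 0} \<subseteq> S" using disp(3) S(3) by simp
    show "{x \<in> V. G 0 x = 0} \<subseteq> S" using Gzero[of 0] by auto
  qed simp
  also have "\<dots> = local_degree (G 1) V"
    by (rule local_degree_homotopy[OF contG S(1,2,4) Gzero])
  also have "\<dots> = local_degree (\<lambda>x. x - f (r' x)) ?V1"
  proof (rule local_degree_cong[OF cG disp'(2) S(1,2,4) cl(2)])
    show "G 1 x = x - f (r' x)" if "x \<in> closure S" for x using ends(2) S(4) that by auto
    show "{x \<in> ?V1. x - f (r' x) = 0} \<subseteq> S" using disp'(3) S(3) by simp
    show "{x \<in> V. G 1 x = 0} \<subseteq> S" using Gzero[of 1] by auto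
  qed simp
  finally show ?thesis .
qed

text \<open>The given retraction supplies the value and forces it, since a number valid for all
  retractions is valid for this one.\<close>

lemma fixed_point_index_eq:
  fixes f :: "'a::euclidean_space \<Rightarrow> 'a"
  assumes "continuous_on X f" "f \<in> X \<rightarrow> X" "openin (top_of_set X) U" "compact {x\<in>U. f x = x}"
    and "open W" "retraction W X r"
  shows "fixed_point_index X f U = local_degree (\<lambda>x. x - f (r x)) {x\<in>W. r x \<in> U}"
  unfolding fixed_point_index_def
proof (rule the_equality)
  show "\<forall>W' r'. open W' \<and> retraction W' X r' \<longrightarrow>
      local_degree (\<lambda>x. x - f (r' x)) {x\<in>W'. r' x \<in> U} = local_degree (\<lambda>x. x - f (r x)) {x\<in>W. r x \<in> U}"
    using local_degree_retraction_unique[OF assms(1-4) _ _ assms(5,6)] by blast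
qed (use assms(5,6) in blast)

lemma fixed_point_index_prod:
  fixes f1 :: "'a::euclidean_space \<Rightarrow> 'a" and f2 :: "'b::euclidean_space \<Rightarrow> 'b"
  assumes 1: "continuous_on X1 f1" "f1 \<in> X1 \<rightarrow> X1" "openin (top_of_set X1) U1" "compact {x\<in>U1. f1 x = x}"
    and 2: "continuous_on X2 f2" "f2 \<in> X2 \<rightarrow> X2" "openin (top_of_set X2) U2" "compact {x\<in>U2. f2 x = x}"
    and ENR: "ENR X1" "ENR X2"
  shows "fixed_point_index (X1 \<times> X2) (map_prod f1 f2) (U1 \<times> U2)
    = fixed_point_index X1 f1 U1 * fixed_point_index X2 f2 U2"
proof -
  obtain W1 r1 where W1: "open W1" "retraction W1 X1 r1"
    using ENR(1) by (auto simp: ENR_def retract_of_def)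
  obtain W2 r2 where W2: "open W2" "retraction W2 X2 r2"
    using ENR(2) by (auto simp: ENR_def retract_of_def)
  let ?g1 = "\<lambda>x. x - f1 (r1 x)" and ?g2 = "\<lambda>x. x - f2 (r2 x)"
  let ?V1 = "{x\<in>W1. r1 x \<in> U1}" and ?V2 = "{x\<in>W2. r2 x \<in> U2}"
  have c: "continuous_on (A \<times> B) (map_prod k l)" if "continuous_on A k" "continuous_on B l"
    for k :: "'a \<Rightarrow> 'a" and l :: "'b \<Rightarrow> 'b" and A B
    unfolding map_prod_def case_prod_unfold
    by (intro continuous_on_Pair continuous_on_compose2[OF that(1)] continuous_on_compose2[OF that(2)]
        continuous_on_fst continuous_on_snd continuous_on_id) auto
  have "retraction (W1 \<times> W2) (X1 \<times> X2) (map_prod r1 r2)"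
    using W1(2) W2(2) by (auto simp: retraction_def intro!: c)
  moreover have "open (W1 \<times> W2)" by (rule open_Times[OF W1(1) W2(1)])
  moreover have "map_prod f1 f2 \<in> X1 \<times> X2 \<rightarrow> X1 \<times> X2" using 1(2) 2(2) by auto
  moreover have "openin (top_of_set (X1 \<times> X2)) (U1 \<times> U2)" by (rule openin_Times[OF 1(3) 2(3)])
  moreover have "compact {z \<in> U1 \<times> U2. map_prod f1 f2 z = z}"
  proof -
    have "{z \<in> U1 \<times> U2. map_prod f1 f2 z = z} = {x\<in>U1. f1 x = x} \<times> {x\<in>U2. f2 x = x}" by auto
    then show ?thesis using compact_Times[OF 1(4) 2(4)] by simp
  qed
  ultimately have "fixed_point_index (X1 \<times> X2) (map_prod f1 f2) (U1 \<times> U2) =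
      local_degree (\<lambda>z. z - map_prod f1 f2 (map_prod r1 r2 z)) {z \<in> W1 \<times> W2. map_prod r1 r2 z \<in> U1 \<times> U2}"
    by (intro fixed_point_index_eq c[OF 1(1) 2(1)])
  also have "(\<lambda>z. z - map_prod f1 f2 (map_prod r1 r2 z)) = (\<lambda>z. (?g1 (fst z), ?g2 (snd z)))"
    by (auto simp: fun_eq_iff)
  also have "{z \<in> W1 \<times> W2. map_prod r1 r2 z \<in> U1 \<times> U2} = ?V1 \<times> ?V2" by auto
  also have "local_degree (\<lambda>z. (?g1 (fst z), ?g2 (snd z))) (?V1 \<times> ?V2) = local_degree ?g1 ?V1 * local_degree ?g2 ?V2"
  proof (rule local_degree_prod)
    show "compact {x \<in> ?V1. ?g1 x = 0}" using 1(4) retraction_displacement(3)[OF 1(1-3) W1] by simp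
    show "compact {x \<in> ?V2. ?g2 x = 0}" using 2(4) retraction_displacement(3)[OF 2(1-3) W2] by simp
  qed (rule retraction_displacement[OF 1(1-3) W1] retraction_displacement[OF 2(1-3) W2])+
  finally show ?thesis
    by (simp only: fixed_point_index_eq[OF 1 W1] fixed_point_index_eq[OF 2 W2])
qed

section \<open>Polyhedra and fixed points in the interior\<close>

lemma simplicial_complex_polyhedron:
  assumes "simplicial_complex C"
  shows "compact (\<Union>C)" "ENR (\<Union>C)"
proof -
  have C: "finite C" "\<And>S. S \<in> C \<Longrightarrow> \<exists>n. n simplex S"
    using assms by (auto simp: simplicial_complex_def)
  have comp: "compact S" if "S \<in> C" for S
    using C(2)[OF that] compact_simplex by blast
  show "compact (\<Union>C)" using C(1) comp by (rule compact_Union)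
  show "ENR (\<Union>C)"
    by (rule ENR_finite_Union_convex_closed[OF C(1)])
      (use C(2) closed_simplex convex_simplex in blast)+
qed

text \<open>With none on the boundary, the fixed points in the interior are those in the closure, a
  closed subset of a compact set.\<close>

lemma compact_fixed_points_interior_of:
  fixes f :: "'a::euclidean_space \<Rightarrow> 'a"
  assumes X: "compact X" "continuous_on X f"
    and fix_free: "\<forall>x \<in> (top_of_set X closure_of A) - (top_of_set X interior_of A). f x \<noteq> x"
  shows "compact {x \<in> top_of_set X interior_of A. f x = x}"
proof -
  let ?C = "top_of_set X closure_of A"
  have CX: "?C \<subseteq> X" using closure_of_subset_topspace[of "top_of_set X" A] by simp
  have "{x \<in> top_of_set X interior_of A. f x = x} = {x \<in> ?C. f x - x = 0}"
    using fix_free interior_of_subset_closure_of[of "top_of_set X" A] by auto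
  moreover have compC: "compact ?C"
    by (rule closedin_compact[OF X(1) closedin_closure_of])
  moreover have "closed {x \<in> ?C. f x - x = 0}"
    by (intro continuous_closed_preimage_constant continuous_intros continuous_on_subset[OF X(2) CX]
        compact_imp_closed compC)
  ultimately show ?thesis
    using compact_Int_closed[OF compC, of "{x \<in> ?C. f x - x = 0}"] by (simp add: Collect_conj_eq Int_absorb1)
qed

theorem theorem3p5:
  fixes C\<^sub>1 :: "'a::euclidean_space set set" and C\<^sub>2 :: "'b::euclidean_space set set"
    and X\<^sub>1 A\<^sub>1 :: "'a set" and X\<^sub>2 A\<^sub>2 :: "'b set"
    and f\<^sub>1 :: "'a \<Rightarrow> 'a" and f\<^sub>2 :: "'b \<Rightarrow> 'b"
  assumes "simplicial_complex C\<^sub>1" and "X\<^sub>1 = \<Union>C\<^sub>1"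
    and "simplicial_complex C\<^sub>2" and "X\<^sub>2 = \<Union>C\<^sub>2"
    and "continuous_on X\<^sub>1 f\<^sub>1" and "f\<^sub>1 \<in> X\<^sub>1 \<rightarrow> X\<^sub>1"
    and "continuous_on X\<^sub>2 f\<^sub>2" and "f\<^sub>2 \<in> X\<^sub>2 \<rightarrow> X\<^sub>2"
    and "A\<^sub>1 \<subseteq> X\<^sub>1" and "A\<^sub>2 \<subseteq> X\<^sub>2"
    and "\<forall>x \<in> (top_of_set X\<^sub>1 closure_of A\<^sub>1) - (top_of_set X\<^sub>1 interior_of A\<^sub>1). f\<^sub>1 x \<noteq> x"
    and "\<forall>x \<in> (top_of_set X\<^sub>2 closure_of A\<^sub>2) - (top_of_set X\<^sub>2 interior_of A\<^sub>2). f\<^sub>2 x \<noteq> x"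
  shows "combinatorial_index (X\<^sub>1 \<times> X\<^sub>2) (map_prod f\<^sub>1 f\<^sub>2) (A\<^sub>1 \<times> A\<^sub>2)
         = combinatorial_index X\<^sub>1 f\<^sub>1 A\<^sub>1 * combinatorial_index X\<^sub>2 f\<^sub>2 A\<^sub>2"
proof -
  have X1: "compact X\<^sub>1" "ENR X\<^sub>1" and X2: "compact X\<^sub>2" "ENR X\<^sub>2"
    using simplicial_complex_polyhedron[OF assms(1)] simplicial_complex_polyhedron[OF assms(3)] assms(2,4)
    by simp_all
  \<comment> \<open>Interiors commute with binary products, so the open set behind the left-hand
    side is a product set.\<close>
  have "top_of_set (X\<^sub>1 \<times> X\<^sub>2) interior_of (A\<^sub>1 \<times> A\<^sub>2) =
      (top_of_set X\<^sub>1 interior_of A\<^sub>1) \<times> (top_of_set X\<^sub>2 interior_of A\<^sub>2)"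
    by (metis interior_of_Times prod_topology_subtopology_eu)
  then show ?thesis
    unfolding combinatorial_index_def
    using fixed_point_index_prod[OF assms(5,6) openin_interior_of
        compact_fixed_points_interior_of[OF X1(1) assms(5,11)]
        assms(7,8) openin_interior_of compact_fixed_points_interior_of[OF X2(1) assms(7,12)] X1(2) X2(2)]
    by simp
qed

end
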